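(* Let $p,q,s$ be integers with $p\ge 3$, $q\ge 1$, $\gcd(p,q)=1$, and suppose $s=2n$ for some negative integer $n$. Let $k,\ell$ be the integers determined by $p,q$ as in the context. Then the Jones polynomial of the twisted torus knot $T((p,q),(2,s))=T(p,q,2,n)$ is $$\frac{t^{\frac{(p-1)(q-1)-|s|}{2}}}{1-t^{2}}\left[J'_{p,q}-\sum_{i=0}^{|s|-1}(-1)^i\, t^{\,i-|s|+k+\ell-k\ell+\frac{kq+\ell p+1}{2}}\,J'_{p-2k,q-2\ell}\right],$$ where $J'_{p,q}=1-t^{p+1}-t^{q+1}+t^{p+q}$ and $J'_{p-2k,q-2\ell}=1-t^{p+1-2k}-t^{q+1-2\ell}+t^{p+q-2k-2\ell}$.
   Context: The twisted torus link $T((p,q),(2,s))$ is the closure of the braid $(\sigma_1\sigma_2\cdots\sigma_{p-1})^q\sigma_1^{s}$ on $p$ strands, where $\sigma_i$ are the standard braid generators, with all strands oriented in parallel and each $\sigma_i$ a positive crossing (writhe $+1$). When $s=2n$ it is the twisted torus knot $T(p,q,2,n)$, obtained from the $(p,q)$-torus knot by adding $n$ full twists to $2$ adjacent strands. The Jones polynomial $V(L)$ is defined via the Kauffman bracket: $\langle\bigcirc\rangle=1$, $\langle L\sqcup\bigcirc\rangle=(-A^2-A^{-2})\langle L\rangle$, and resolving a crossing $\sigma_i$ of a braid closure gives $\langle\sigma_i\rangle=A\langle \mathrm{id}\rangle+A^{-1}\langle e_i\rangle$, where $\mathrm{id}$ replaces the crossing by two vertical strands and $e_i$ replaces it by a cap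 and a cup (so $\langle\sigma_i^{-1}\rangle=A^{-1}\langle \mathrm{id}\rangle+A\langle e_i\rangle$). The auxiliary polynomial is $X(L)=(-A)^{-3w(L)}\langle L\rangle$, with $w$ the writhe, and $V(L)$ is obtained from $X(L)$ by $A\mapsto t^{-1/4}$. (With this convention the torus knot $T(m,n)$, $m,n>0$, has $V=t^{(m-1)(n-1)/2}(1-t^{m+1}-t^{n+1}+t^{m+n})/(1-t^2)$.) Definition of $k,\ell$: let $\hat q$ be the residue of $q$ modulo $p$. Let $k$ be the smallest positive integer such that $1+\hat q k\equiv i \pmod p$ for some $i\in\{0,1,2\}$, and for this $k$ and the corresponding $i$ let $\ell$ be the integer with $p\ell+i-1=qk$. *)

theory Defs
  imports "HOL-Computational_Algebra.Formal_Laurent_Series" "HOL-Number_Theory.Cong"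
begin

text \<open>
  Braid words on \<open>p\<close> strands, the strand positions being \<open>1, \<dots>, p\<close>: \<open>Sigma i\<close> and
  \<open>SigmaInv i\<close> (for \<open>1 \<le> i < p\<close>) are the generator \<open>\<sigma>\<^sub>i\<close> and its inverse.  A word stands
  for the diagram of its closure, with all strands oriented in parallel.
\<close>

datatype crossing = Sigma nat | SigmaInv nat

definition sigma_pow :: "nat \<Rightarrow> int \<Rightarrow> crossing list" where
  "sigma_pow i s = replicate (nat \<bar>s\<bar>) (if s \<ge> 0 then Sigma i else SigmaInv i)"

definition twisted_torus_braid :: "nat \<Rightarrow> nat \<Rightarrow> int \<Rightarrow> crossing list" where
  "twisted_torus_braid p q s = concat (replicate q (map Sigma [1..<p])) @ sigma_pow 1 s"

fun crossing_sign :: "crossing \<Rightarrow> int" where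
  "crossing_sign (Sigma i) = 1"
| "crossing_sign (SigmaInv i) = -1"

definition writhe :: "crossing list \<Rightarrow> int" where
  "writhe w = sum_list (map crossing_sign w)"

text \<open>
  A crossingless diagram is the closure of a product \<open>e\<^sub>i \<cdot> e\<^sub>j \<cdot> \<dots>\<close> of cup-cap pairs, given by
  the list of their indices.  The point \<open>(x, j)\<close> lies at strand position \<open>x\<close>, between the
  \<open>j\<close>-th and the next factor.  The factor \<open>e\<^sub>i\<close> joins the positions \<open>i\<close> and \<open>i + 1\<close> on either
  side of it and is vertical elsewhere; the last set of arcs closes the diagram up.
\<close>

definition closure_arcs :: "nat \<Rightarrow> nat list \<Rightarrow> ((nat \<times> nat) \<times> (nat \<times> nat)) set" where
  "closure_arcs p es =
     {((x, j), (x, Suc j)) | x j. x \<in> {1..p} \<and> j < length es \<and> x \<noteq> es ! j \<and> x \<noteq> Suc (es ! j)}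
   \<union> {((es ! j, j), (Suc (es ! j), j)) | j. j < length es}
   \<union> {((es ! j, Suc j), (Suc (es ! j), Suc j)) | j. j < length es}
   \<union> {((x, length es), (x, 0)) | x. x \<in> {1..p}}"

definition num_circles :: "nat \<Rightarrow> nat list \<Rightarrow> nat" where
  "num_circles p es =
     card (({1..p} \<times> {0..length es}) // ((closure_arcs p es \<union> (closure_arcs p es)\<inverse>)\<^sup>*))"

text \<open>
  In \<open>resolve A p es w\<close> the crossings of a braid word have been resolved one by one from the
  left: \<open>es\<close> lists the cup-cap pairs produced so far (identity resolutions leave no trace) and
  \<open>w\<close> is the rest of the word.  A crossingless diagram of \<open>c \<ge> 1\<close> circles has bracket
  \<open>(-A\<^sup>2 - A\<^sup>-\<^sup>2) ^ (c - 1)\<close>.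
\<close>

fun resolve :: "'a::field \<Rightarrow> nat \<Rightarrow> nat list \<Rightarrow> crossing list \<Rightarrow> 'a" where
  "resolve A p es [] = (- (A powi 2) - A powi (-2)) ^ (num_circles p es - 1)"
| "resolve A p es (Sigma i # w) =
     A * resolve A p es w + A powi (-1) * resolve A p (es @ [i]) w"
| "resolve A p es (SigmaInv i # w) =
     A powi (-1) * resolve A p es w + A * resolve A p (es @ [i]) w"

definition kauffman_bracket :: "'a::field \<Rightarrow> nat \<Rightarrow> crossing list \<Rightarrow> 'a" where
  "kauffman_bracket A p w = resolve A p [] w"

definition aux_poly :: "'a::field \<Rightarrow> nat \<Rightarrow> crossing list \<Rightarrow> 'a" where
  "aux_poly A p w = (- A) powi (-3 * writhe w) * kauffman_bracket A p w"

text \<open>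
  Laurent polynomials in \<open>t\<^sup>1\<^sup>/\<^sup>4\<close> are viewed inside the field of formal Laurent series whose
  indeterminate \<open>fls_X\<close> is \<open>t\<^sup>1\<^sup>/\<^sup>4\<close>, so that \<open>A\<close> becomes \<open>fls_X powi (-1)\<close>.
\<close>

definition t_half :: "rat fls" where
  "t_half = fls_X ^ 2"

definition t_var :: "rat fls" where
  "t_var = fls_X ^ 4"

definition jones :: "nat \<Rightarrow> crossing list \<Rightarrow> rat fls" where
  "jones p w = aux_poly (fls_X powi (-1)) p w"

definition J' :: "int \<Rightarrow> int \<Rightarrow> rat fls" where
  "J' a b = 1 - t_var powi (a + 1) - t_var powi (b + 1) + t_var powi (a + b)"

definition admissible :: "int \<Rightarrow> int \<Rightarrow> int \<Rightarrow> int \<Rightarrow> bool" where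
  "admissible p q k i \<longleftrightarrow> i \<in> {0, 1, 2} \<and> [1 + (q mod p) * k = i] (mod p)"

definition twist_params :: "int \<Rightarrow> int \<Rightarrow> int \<Rightarrow> int \<Rightarrow> bool" where
  "twist_params p q k l \<longleftrightarrow>
     k > 0 \<and> (\<forall>k'. 0 < k' \<and> k' < k \<longrightarrow> \<not> (\<exists>i. admissible p q k' i))
     \<and> (\<exists>i. admissible p q k i \<and> p * l + i - 1 = q * k)"

end

theory Submission
  imports Defs
begin

text \<open>
  The Kauffman bracket is computed in the spin model of the Temperley-Lieb algebra.  A state
  assigns a spin, up or down, to each of the \<open>p\<close> strands, and a cup-cap pair \<open>e\<^sub>i\<close> acts on
  functions of states through a rank-one matrix in the spins \<open>i\<close> and \<open>i + 1\<close>.  Weighting a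
  state by \<open>z\<close> to the power of its total spin, for a suitable \<open>z\<close>, makes the trace of
  \<open>e\<^sub>i e\<^sub>j \<dots>\<close> the loop value to the power of the number of circles in the closure
  (\<open>qtrace_tl_word\<close>).  The bracket of a braid closure, times the loop value, is therefore the
  weighted trace of the operator in which each \<open>\<sigma>\<^sub>i\<close> is \<open>A + A\<^sup>-\<^sup>1 e\<^sub>i\<close> (\<open>resolve_eq_qtrace\<close>).

  The negative twists are harmless: since \<open>e\<^sub>1\<close> squares to a multiple of itself, a negative
  power of \<open>\<sigma>\<^sub>1\<close> is a combination of the identity and \<open>e\<^sub>1\<close>.  With
  \<open>C = \<sigma>\<^sub>1 \<dots> \<sigma>\<^bsub>p-1\<^esub>\<close> it remains to find the weighted traces of \<open>C\<^sup>q\<close> and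
  \<open>C\<^sup>q e\<^sub>1\<close>.

  The operator \<open>C\<close> carries one strand across all others, and it is almost a rotation of the
  list of spins.  Let \<open>R\<close> be the raising operator of quantum \<open>sl\<^sub>2\<close>; it commutes with every
  \<open>e\<^sub>i\<close>.  There are two rotations \<open>U\<close>, \<open>U'\<close> with weights, and an explicit operator \<open>L\<close>, such
  that \<open>C = U + L R\<close>, \<open>R U = U' R\<close> and \<open>R L = C - U'\<close>.  By telescoping,
  \<open>C\<^sup>q - U\<^sup>q = Z R\<close> and \<open>R Z = C\<^sup>q - U'\<^sup>q\<close> for some \<open>Z\<close>.  As \<open>R\<close> raises the total spin by 2,
  moving it around the trace costs the factor \<open>z\<^sup>2\<close>, so for every \<open>x\<close> that commutes with \<open>R\<close>
  \<open>(z\<^sup>2 - 1) tr (C\<^sup>q x) = z\<^sup>2 tr (U\<^sup>q x) - tr (U'\<^sup>q x)\<close>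
  (\<open>qtrace_coxeter_power\<close>).  The right-hand side can be read off.  For \<open>x = 1\<close> only states
  fixed by the rotation by \<open>q\<close> contribute; as \<open>q\<close> is coprime to \<open>p\<close>, these are the two
  constant states, and they give \<open>J'\<close> at \<open>(p, q)\<close>.  For \<open>x = e\<^sub>1\<close> the rotation is followed by
  an exchange of two neighbouring spins.  This permutation of the positions has two cycles, of
  lengths \<open>k\<close> and \<open>p - k\<close> where \<open>q k\<close> is 1 modulo \<open>p\<close>, and the two states that are opposite
  on these cycles give \<open>J'\<close> at \<open>(p - 2k, q - 2l)\<close>.  The case \<open>q k = p l - 1\<close> reduces to this
  one by the symmetry \<open>(k, l) \<mapsto> (p - k, q - l)\<close> of the formula.
\<close>

section \<open>Operators on functions of spin states\<close>

type_synonym 'a operator = "(bool list \<Rightarrow> 'a) \<Rightarrow> bool list \<Rightarrow> 'a"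

text \<open>
  A spin is a Boolean, \<open>True\<close> being up.  An operator acts on functions of lists of all lengths
  at once; on functions of the lists of length \<open>p\<close> it is a matrix indexed by \<open>states p\<close>.
\<close>

definition states :: "nat \<Rightarrow> bool list set" where
  "states p = {x. length x = p}"

definition basis :: "bool list \<Rightarrow> bool list \<Rightarrow> 'a::field" where
  "basis y x = of_bool (x = y)"

text \<open>
  The third condition says that the operator respects the length; together with the other two
  it makes the operator a matrix on the states of each length (\<open>linear_op_expand\<close>).
\<close>

definition linear_op :: "'a::field operator \<Rightarrow> bool" where
  "linear_op T \<longleftrightarrow>
     (\<forall>f g x. T (\<lambda>y. f y + g y) x = T f x + T g x) \<and>
     (\<forall>c f x. T (\<lambda>y. c * f y) x = c * T f x) \<and>
     (\<forall>f g x. (\<forall>y. length y = length x \<longrightarrow> f y = g y) \<longrightarrow> T f x = T g x)"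

definition same_on :: "nat \<Rightarrow> 'a operator \<Rightarrow> 'a operator \<Rightarrow> bool" where
  "same_on p S T \<longleftrightarrow> (\<forall>f x. length x = p \<longrightarrow> S f x = T f x)"

text \<open>
  Tensoring with the identity on the first strand.
\<close>

fun on_tail :: "'a::field operator \<Rightarrow> 'a operator" where
  "on_tail T f [] = 0"
| "on_tail T f (b # v) = T (\<lambda>w. f (b # w)) v"

lemma states_0 [simp]: "states 0 = {[]}"
  by (auto simp: states_def)

lemma states_Suc: "states (Suc p) = (#) True ` states p \<union> (#) False ` states p"
proof -
  have "x \<in> (#) True ` states p \<union> (#) False ` states p" if "length x = Suc p" for x
    using that by (cases x) (auto simp: states_def)
  thus ?thesis by (auto simp: states_def)
qed

lemma finite_states [simp]: "finite (states p)"
  by (induction p) (auto simp: states_Suc)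

lemma sum_states_Suc:
  "(\<Sum>x\<in>states (Suc p). h x) = (\<Sum>v\<in>states p. h (True # v)) + (\<Sum>v\<in>states p. h (False # v))"
  unfolding states_Suc
  by (subst sum.union_disjoint) (auto simp: sum.reindex)

lemma linear_op_add: "linear_op T \<Longrightarrow> T (\<lambda>y. f y + g y) x = T f x + T g x"
  and linear_op_scale: "linear_op T \<Longrightarrow> T (\<lambda>y. c * f y) x = c * T f x"
  and linear_op_cong:
    "linear_op T \<Longrightarrow> (\<And>y. length y = length x \<Longrightarrow> f y = g y) \<Longrightarrow> T f x = T g x"
  by (auto simp: linear_op_def)

lemma linear_op_zero: "linear_op T \<Longrightarrow> T (\<lambda>_. 0) x = 0"
  using linear_op_scale[of T 0 "\<lambda>_. 0" x] by simp

lemma linear_op_sum: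
  assumes "linear_op T"
  shows "T (\<lambda>y. \<Sum>i\<in>I. f i y) x = (\<Sum>i\<in>I. T (f i) x)"
proof (induction I rule: infinite_finite_induct)
  case (insert i I)
  thus ?case using linear_op_add[OF assms, of "f i" "\<lambda>y. \<Sum>i\<in>I. f i y"] by simp
qed (auto simp: linear_op_zero[OF assms])

lemma linear_op_expand:
  assumes "linear_op T"
  shows "T f x = (\<Sum>y\<in>states (length x). f y * T (basis y) x)"
proof -
  have "T f x = T (\<lambda>z. \<Sum>y\<in>states (length x). f y * basis y z) x"
  proof (rule linear_op_cong[OF assms])
    fix z :: "bool list" assume "length z = length x"
    hence "z \<in> states (length x)" by (simp add: states_def)
    thus "f z = (\<Sum>y\<in>states (length x). f y * basis y z)"
      by (simp add: basis_def of_bool_def if_distrib[of "\<lambda>t. _ * t"] cong: if_cong)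
  qed
  also have "\<dots> = (\<Sum>y\<in>states (length x). f y * T (basis y) x)"
    by (simp add: linear_op_sum[OF assms] linear_op_scale[OF assms])
  finally show ?thesis .
qed

lemma linear_op_id [simp]: "linear_op (\<lambda>f. f)" "linear_op id"
  by (auto simp: linear_op_def)

lemma linear_op_comp:
  assumes "linear_op S" "linear_op T"
  shows "linear_op (\<lambda>f. S (T f))"
proof -
  have 1: "T (\<lambda>y. f y + g y) = (\<lambda>y. T f y + T g y)" for f g
    using linear_op_add[OF assms(2)] by blast
  have 2: "T (\<lambda>y. c * f y) = (\<lambda>y. c * T f y)" for c f
    using linear_op_scale[OF assms(2)] by blast
  have 3: "S (T f) x = S (T g) x" if "\<forall>y. length y = length x \<longrightarrow> f y = g y" for f g x
    by (rule linear_op_cong[OF assms(1)], rule linear_op_cong[OF assms(2)]) (use that in auto)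
  show ?thesis unfolding linear_op_def
    using 3 by (auto simp: 1 2 linear_op_add[OF assms(1)] linear_op_scale[OF assms(1)])
qed

lemma linear_op_lincomb:
  assumes "linear_op S" "linear_op T"
  shows "linear_op (\<lambda>f x. c * S f x + d * T f x)"
proof -
  have "c * S f x + d * T f x = c * S g x + d * T g x"
    if "\<forall>y. length y = length x \<longrightarrow> f y = g y" for f g x
    using linear_op_cong[OF assms(1), of x f g] linear_op_cong[OF assms(2), of x f g] that by simp
  thus ?thesis
    unfolding linear_op_def
    by (auto simp: linear_op_add[OF assms(1)] linear_op_add[OF assms(2)]
      linear_op_scale[OF assms(1)] linear_op_scale[OF assms(2)] algebra_simps)
qed

lemma linear_op_on_tail:
  assumes "linear_op T" shows "linear_op (on_tail T)"
proof -
  have "on_tail T (\<lambda>y. f y + g y) x = on_tail T f x + on_tail T g x" for f g x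
    by (cases x) (simp_all add: linear_op_add[OF assms])
  moreover have "on_tail T (\<lambda>y. c * f y) x = c * on_tail T f x" for c f x
    by (cases x) (simp_all add: linear_op_scale[OF assms])
  moreover have "on_tail T f x = on_tail T g x" if "\<forall>y. length y = length x \<longrightarrow> f y = g y" for f g x
    using that by (cases x) (auto intro!: linear_op_cong[OF assms])
  ultimately show ?thesis unfolding linear_op_def by blast
qed

fun spin :: "bool list \<Rightarrow> int" where
  "spin [] = 0"
| "spin (b # v) = (if b then 1 else -1) + spin v"

lemma spin_append [simp]: "spin (u @ v) = spin u + spin v"
  by (induction u) auto

definition qtrace :: "'a::field \<Rightarrow> nat \<Rightarrow> 'a operator \<Rightarrow> 'a" where
  "qtrace z p T = (\<Sum>x\<in>states p. z powi spin x * T (basis x) x)"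

definition shifts_spin :: "int \<Rightarrow> 'a::field operator \<Rightarrow> bool" where
  "shifts_spin d T \<longleftrightarrow> (\<forall>x y. length x = length y \<longrightarrow> T (basis y) x \<noteq> 0 \<longrightarrow> spin x = spin y + d)"

text \<open>
  Cyclicity of the trace holds up to the weight: an entry of \<open>S\<close> links states whose spins
  differ by \<open>d\<close>.
\<close>

lemma qtrace_commute:
  assumes "z \<noteq> 0" "linear_op S" "linear_op T" "shifts_spin d S"
  shows "qtrace z p (\<lambda>f. S (T f)) = z powi d * qtrace z p (\<lambda>f. T (S f))"
proof -
  have "qtrace z p (\<lambda>f. S (T f)) =
      (\<Sum>x\<in>states p. \<Sum>y\<in>states p. z powi spin x * (T (basis x) y * S (basis y) x))"
    unfolding qtrace_def
    by (intro sum.cong refl, subst linear_op_expand[OF assms(2)])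
      (simp add: states_def sum_distrib_left)
  also have "\<dots> = (\<Sum>y\<in>states p. \<Sum>x\<in>states p. z powi spin x * (T (basis x) y * S (basis y) x))"
    by (rule sum.swap)
  also have "\<dots> = (\<Sum>y\<in>states p. \<Sum>x\<in>states p. z powi d * (z powi spin y * (S (basis y) x * T (basis x) y)))"
  proof (intro sum.cong refl)
    fix x y assume xy: "y \<in> states p" "x \<in> states p"
    show "z powi spin x * (T (basis x) y * S (basis y) x) =
      z powi d * (z powi spin y * (S (basis y) x * T (basis x) y))"
    proof (cases "S (basis y) x = 0")
      case False
      hence "spin x = spin y + d" using assms(4) xy unfolding shifts_spin_def states_def by auto
      thus ?thesis using assms(1) by (simp add: power_int_add)
    qed simp
  qed
  also have "\<dots> = z powi d * qtrace z p (\<lambda>f. T (S f))"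
    unfolding qtrace_def
    by (subst sum_distrib_left, intro sum.cong refl, subst linear_op_expand[OF assms(3)])
      (simp add: states_def sum_distrib_left)
  finally show ?thesis .
qed

lemma qtrace_same: "same_on p S T \<Longrightarrow> qtrace z p S = qtrace z p T"
  unfolding qtrace_def same_on_def states_def by simp

lemma qtrace_lincomb:
  "qtrace z p (\<lambda>f x. c * S f x + d * T f x) = c * qtrace z p S + d * qtrace z p T"
  unfolding qtrace_def by (simp add: sum_distrib_left sum.distrib algebra_simps)

lemma shifts_spin_comp:
  assumes "linear_op S" "shifts_spin c S" "shifts_spin d T"
  shows "shifts_spin (c + d) (\<lambda>f. S (T f))"
  unfolding shifts_spin_def
proof (intro allI impI)
  fix x y :: "bool list" assume l: "length x = length y" and n: "S (T (basis y)) x \<noteq> 0"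
  from n have "(\<Sum>w\<in>states (length x). T (basis y) w * S (basis w) x) \<noteq> 0"
    by (subst (asm) linear_op_expand[OF assms(1)])
  then obtain w where "w \<in> states (length x)" "T (basis y) w * S (basis w) x \<noteq> 0"
    by (meson sum.not_neutral_contains_not_neutral)
  hence "length x = length w" "length w = length y" "S (basis w) x \<noteq> 0" "T (basis y) w \<noteq> 0"
    using l by (auto simp: states_def)
  hence "spin x = spin w + c" "spin w = spin y + d"
    using assms(2,3) unfolding shifts_spin_def by blast+
  thus "spin x = spin y + (c + d)" by simp
qed

lemma shifts_spin_id [simp]: "shifts_spin 0 (\<lambda>f. f)" "shifts_spin 0 id"
  unfolding shifts_spin_def basis_def by auto

lemma basis_Cons: "(\<lambda>w. basis (c # y) (b # w)) = (if b = c then basis y else (\<lambda>_. 0))"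
  by (auto simp: basis_def fun_eq_iff)

lemma shifts_spin_on_tail:
  assumes "linear_op T" "shifts_spin d T"
  shows "shifts_spin d (on_tail T)"
  unfolding shifts_spin_def
proof (intro allI impI)
  fix x y :: "bool list" assume "length x = length y" "on_tail T (basis y) x \<noteq> 0"
  thus "spin x = spin y + d"
    using assms(2)
    by (cases x; cases y)
      (auto simp: basis_Cons linear_op_zero[OF assms(1)] shifts_spin_def split: if_splits)
qed

lemma qtrace_on_tail:
  assumes "linear_op T" "z \<noteq> 0"
  shows "qtrace z (Suc p) (on_tail T) = (z + inverse z) * qtrace z p T"
  using assms(2)
  by (simp add: qtrace_def sum_states_Suc basis_Cons power_int_add power_int_diff distrib_right
     sum_distrib_left divide_inverse mult_ac sum.distrib)

section \<open>The Temperley-Lieb generators\<close>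

text \<open>
  On the spin pairs up-down and down-up this is the rank-one matrix with rows \<open>(a, 1)\<close> and
  \<open>(1, 1/a)\<close>, and it vanishes on equal spins.  Its trace \<open>a + 1/a\<close> is the value of a circle.
\<close>

fun cup_cap :: "'a::field \<Rightarrow> 'a operator" where
  "cup_cap a f (b # c # v) =
     (if b = c then 0
      else (if b then 1 else inverse a) * (a * f (True # False # v) + f (False # True # v)))"
| "cup_cap a f [b] = 0"
| "cup_cap a f [] = 0"

text \<open>
  Strand positions are counted from 1, so \<open>tl_gen a i\<close> acts on the positions \<open>i\<close> and \<open>i + 1\<close>;
  the value at 0 is a default.
\<close>

fun tl_gen :: "'a::field \<Rightarrow> nat \<Rightarrow> 'a operator" where
  "tl_gen a 0 = (\<lambda>f x. 0)"
| "tl_gen a (Suc 0) = cup_cap a"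
| "tl_gen a (Suc (Suc i)) = on_tail (tl_gen a (Suc i))"

fun tl_word :: "'a::field \<Rightarrow> nat list \<Rightarrow> 'a operator" where
  "tl_word a [] = (\<lambda>f. f)"
| "tl_word a (i # w) = (\<lambda>f. tl_gen a i (tl_word a w f))"

lemma linear_op_null: "linear_op (\<lambda>f x. 0)"
  by (simp add: linear_op_def)

lemma linear_op_cup_cap: "linear_op (cup_cap a)"
proof -
  have "cup_cap a (\<lambda>y. f y + g y) x = cup_cap a f x + cup_cap a g x" for f g x
    by (cases "(a, f, x)" rule: cup_cap.cases) (auto simp: algebra_simps)
  moreover have "cup_cap a (\<lambda>y. c * f y) x = c * cup_cap a f x" for c f x
    by (cases "(a, f, x)" rule: cup_cap.cases) (auto simp: algebra_simps)
  moreover have "cup_cap a f x = cup_cap a g x" if "\<forall>y. length y = length x \<longrightarrow> f y = g y" for f g x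
    using that by (cases "(a, f, x)" rule: cup_cap.cases) auto
  ultimately show ?thesis unfolding linear_op_def by blast
qed

lemma linear_op_tl_gen: "linear_op (tl_gen a i)"
  by (induction a i rule: tl_gen.induct)
    (auto simp: linear_op_cup_cap linear_op_on_tail linear_op_null)

lemma linear_op_tl_word: "linear_op (tl_word a w)"
  by (induction w) (auto intro: linear_op_comp linear_op_tl_gen)

lemma tl_word_append: "tl_word a (u @ v) = (\<lambda>f. tl_word a u (tl_word a v f))"
  by (induction u) auto

lemma shifts_spin_cup_cap: "shifts_spin 0 (cup_cap (a::'a::field))"
  unfolding shifts_spin_def
proof (intro allI impI)
  fix x y :: "bool list" assume "cup_cap a (basis y) x \<noteq> 0"
  thus "spin x = spin y + 0"
    by (cases "(a, basis y :: bool list \<Rightarrow> 'a, x)" rule: cup_cap.cases) (auto simp: basis_def of_bool_def split: if_splits)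
qed

lemma shifts_spin_tl_gen: "shifts_spin 0 (tl_gen a i)"
proof (induction a i rule: tl_gen.induct)
  case (1 a)
  show ?case by (simp add: shifts_spin_def)
qed (auto intro: shifts_spin_cup_cap shifts_spin_on_tail linear_op_tl_gen simp del: )

lemma shifts_spin_tl_word: "shifts_spin 0 (tl_word a w)"
proof (induction w)
  case (Cons i w)
  thus ?case using shifts_spin_comp[OF linear_op_tl_gen shifts_spin_tl_gen Cons] by simp
qed simp

lemma tl_gen_Suc: "i \<ge> 1 \<Longrightarrow> tl_gen a (Suc i) = on_tail (tl_gen a i)"
  by (cases i) auto

lemma tl_word_map_Suc:
  "set w \<subseteq> {1..} \<Longrightarrow> length x > 0 \<Longrightarrow> tl_word a (map Suc w) f x = on_tail (tl_word a w) f x"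
proof (induction w arbitrary: f x)
  case Nil
  thus ?case by (cases x) auto
next
  case (Cons i w)
  then obtain b v where x: "x = b # v" by (cases x) auto
  have "tl_word a (map Suc (i # w)) f x = tl_gen a i (\<lambda>w'. tl_word a (map Suc w) f (b # w')) v"
    using Cons.prems by (simp add: tl_gen_Suc x)
  also have "(\<lambda>w'. tl_word a (map Suc w) f (b # w')) = (\<lambda>w'. tl_word a w (\<lambda>u. f (b # u)) w')"
    using Cons.IH[of "b # _"] Cons.prems by (simp add: fun_eq_iff)
  finally show ?case by (simp add: x)
qed

lemma tl_gen_idem:
  assumes "a \<noteq> 0" "1 \<le> i" "i < length x"
  shows "tl_gen a i (tl_gen a i f) x = (a + inverse a) * tl_gen a i f x"
  using assms
proof (induction a i arbitrary: x f rule: tl_gen.induct)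
  case (2 a)
  then obtain b c v where "x = b # c # v" by (cases "(a, f, x)" rule: cup_cap.cases) auto
  thus ?case using 2 by (auto simp: field_simps)
next
  case (3 a i)
  then obtain b v where "x = b # v" by (cases x) auto
  thus ?case using 3(1)[of v "\<lambda>w. f (b # w)"] 3(2-) by simp
qed simp

lemma tl_gen_braid:
  assumes "a \<noteq> 0" "1 \<le> i" "Suc i < length x"
  shows "tl_gen a i (tl_gen a (Suc i) (tl_gen a i f)) x = tl_gen a i f x"
  using assms
proof (induction a i arbitrary: x f rule: tl_gen.induct)
  case (2 a)
  then obtain b c d v where "x = b # c # d # v"
    by (metis One_nat_def Suc_leI length_0_conv less_nat_zero_code list.exhaust list.size(4) add.commute plus_1_eq_Suc less_Suc_eq_0_disj not_less_eq)
  thus ?case using 2 by (cases d) (auto simp: field_simps)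
next
  case (3 a i)
  then obtain b v where "x = b # v" by (cases x) auto
  thus ?case using 3(1)[of v "\<lambda>w. f (b # w)"] 3(2-) by (simp add: tl_gen_Suc)
qed simp

lemma tl_gen_commute:
  assumes "1 \<le> i" "i + 2 \<le> j" "j < length x"
  shows "tl_gen a i (tl_gen a j f) x = tl_gen a j (tl_gen a i f) x"
  using assms
proof (induction a i arbitrary: x f j rule: tl_gen.induct)
  case (2 a)
  then obtain k where j: "j = Suc (Suc (Suc k))" 
    by (metis add_2_eq_Suc' add_Suc nat_le_iff_add numeral_2_eq_2 plus_1_eq_Suc)
  from 2 obtain b c v where x: "x = b # c # v" by (cases "(a, f, x)" rule: cup_cap.cases) auto
  note lin = linear_op_tl_gen[of a "Suc k"]
  show ?case
    by (auto simp: j x linear_op_scale[OF lin] linear_op_add[OF lin] linear_op_zero[OF lin])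
next
  case (3 a i)
  then obtain b v where x: "x = b # v" by (cases x) auto
  obtain k where j: "j = Suc (Suc k)" using 3 by (metis Suc_le_D add_2_eq_Suc' Suc_le_mono)
  show ?case using 3(1)[of "Suc k" v "\<lambda>w. f (b # w)"] 3(2-) by (simp add: x j)
qed simp

text \<open>
  The exponent \<open>c\<close> serves all \<open>a\<close> simultaneously.  This is what later allows it to be
  identified at the single value \<open>a = 1\<close>.
\<close>

definition tl_reduces :: "'a::field itself \<Rightarrow> nat \<Rightarrow> nat \<Rightarrow> nat list \<Rightarrow> nat list \<Rightarrow> bool" where
  "tl_reduces _ p c w w' \<longleftrightarrow>
     (\<forall>a::'a. a \<noteq> 0 \<longrightarrow> (\<forall>f x. length x = p \<longrightarrow>
        tl_word a w f x = (a + inverse a) ^ c * tl_word a w' f x))"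

lemma tl_reduces_refl: "tl_reduces TYPE('a::field) p 0 w w"
  by (simp add: tl_reduces_def)

lemma tl_reduces_trans:
  "tl_reduces TYPE('a::field) p c u v \<Longrightarrow> tl_reduces TYPE('a) p d v w \<Longrightarrow>
   tl_reduces TYPE('a) p (c + d) u w"
  by (simp add: tl_reduces_def power_add mult.assoc)

lemma tl_reduces_trans0 [trans]:
  "tl_reduces TYPE('a::field) p 0 u v \<Longrightarrow> tl_reduces TYPE('a) p d v w \<Longrightarrow> tl_reduces TYPE('a) p d u w"
  by (simp add: tl_reduces_def)

lemma tl_reduces_context:
  assumes "tl_reduces TYPE('a::field) p c w w'"
  shows "tl_reduces TYPE('a) p c (u @ w @ v) (u @ w' @ v)"
  unfolding tl_reduces_def
proof (intro allI impI)
  fix a :: 'a and f and x :: "bool list" assume a: "a \<noteq> 0" "length x = p"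
  have "tl_word a (u @ w @ v) f x
      = tl_word a u (\<lambda>y. (a + inverse a) ^ c * tl_word a w' (tl_word a v f) y) x"
    using assms a by (auto simp: tl_word_append tl_reduces_def intro!: linear_op_cong[OF linear_op_tl_word])
  thus "tl_word a (u @ w @ v) f x = (a + inverse a) ^ c * tl_word a (u @ w' @ v) f x"
    by (simp add: tl_word_append linear_op_scale[OF linear_op_tl_word])
qed

lemma tl_reduces_commute:
  assumes "1 \<le> m" "m < p" "set w \<subseteq> {m + 2..<p}"
  shows "tl_reduces TYPE('a::field) p 0 (m # w) (w @ [m])"
  using assms(3)
proof (induction w)
  case (Cons j w)
  have "tl_reduces TYPE('a) p 0 ([m, j] @ w) ([j, m] @ w)"
  proof -
    have "tl_reduces TYPE('a) p 0 [m, j] [j, m]"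
      using assms Cons.prems by (simp add: tl_reduces_def tl_gen_commute)
    from tl_reduces_context[OF this, of "[]" w] show ?thesis by simp
  qed
  moreover have "tl_reduces TYPE('a) p 0 ([j] @ (m # w) @ []) ([j] @ (w @ [m]) @ [])"
    by (rule tl_reduces_context) (use Cons in auto)
  ultimately show ?case using tl_reduces_trans0 by fastforce
qed (simp add: tl_reduces_refl)

lemma count_list_split:
  assumes "count_list w m \<ge> 2"
  obtains u s v where "w = u @ [m] @ s @ [m] @ v" "m \<notin> set s"
proof -
  have "m \<in> set w" using assms by (metis count_list_0_iff not_numeral_le_zero)
  then obtain u w1 where 1: "w = u @ m # w1" "m \<notin> set u" by (meson split_list_first)
  hence "count_list w1 m \<ge> 1" using assms by (auto simp: count_notin)
  hence "m \<in> set w1" by (metis count_list_0_iff not_one_le_zero)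
  then obtain s v where "w1 = s @ m # v" "m \<notin> set s" by (meson split_list_first)
  with 1 that show ?thesis by auto
qed

lemma subset_atLeastLessThan_Suc:
  fixes A :: "nat set"
  assumes "A \<subseteq> {m..<p}" "m \<notin> A"
  shows "A \<subseteq> {Suc m..<p}"
proof
  fix i assume "i \<in> A"
  moreover from this have "i \<noteq> m" using assms(2) by metis
  ultimately show "i \<in> {Suc m..<p}" using subsetD[OF assms(1), of i] by simp
qed

text \<open>
  Between two occurrences of the smallest letter \<open>m\<close>, all letters but \<open>m + 1\<close> commute with
  \<open>m\<close>.  Hence the two occurrences either meet and merge, or enclose a single \<open>m + 1\<close>, which
  the relation \<open>e\<^sub>m e\<^bsub>m+1\<^esub> e\<^sub>m = e\<^sub>m\<close> absorbs.
\<close>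

lemma tl_reduces_merge:
  assumes "1 \<le> m" "m < p" "set s \<subseteq> {Suc m..<p}" "count_list s (Suc m) \<le> 1"
  shows "\<exists>c s'. tl_reduces TYPE('a::field) p c ([m] @ s @ [m]) s' \<and>
           set s' \<subseteq> {m..<p} \<and> count_list s' m = 1"
proof (cases "Suc m \<in> set s")
  case False
  have sub: "set s \<subseteq> {m + 2..<p}"
    using subset_atLeastLessThan_Suc[OF assms(3) False] by simp
  have "tl_reduces TYPE('a) p 0 ([] @ (m # s) @ [m]) ([] @ (s @ [m]) @ [m])"
    by (rule tl_reduces_context, rule tl_reduces_commute) (use assms sub in auto)
  moreover have "tl_reduces TYPE('a) p 1 (s @ [m, m] @ []) (s @ [m] @ [])"
    by (rule tl_reduces_context) (use assms in \<open>simp add: tl_reduces_def tl_gen_idem\<close>)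
  ultimately have "tl_reduces TYPE('a) p 1 ([m] @ s @ [m]) (s @ [m])"
    using tl_reduces_trans0 by fastforce
  moreover have "m \<notin> set s" using assms(3) by auto
  ultimately show ?thesis using assms
    by (intro exI[of _ 1] exI[of _ "s @ [m]"]) (auto simp: count_notin)
next
  case True
  then obtain u v where s: "s = u @ Suc m # v" "Suc m \<notin> set u" by (meson split_list_first)
  have "count_list v (Suc m) = 0" using assms(4) by (simp add: s count_list_append)
  hence nv: "Suc m \<notin> set v" by (simp add: count_list_0_iff)
  have uv: "set u \<subseteq> {Suc m..<p}" "set v \<subseteq> {Suc m..<p}" and m: "Suc m < p" "m \<notin> set u" "m \<notin> set v"
    using assms(3) by (auto simp: s)
  have sub: "set u \<subseteq> {m + 2..<p}" "set v \<subseteq> {m + 2..<p}"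
    using subset_atLeastLessThan_Suc[OF uv(1) s(2)] subset_atLeastLessThan_Suc[OF uv(2) nv] by simp_all
  have 1: "tl_reduces TYPE('a) p 0 ([] @ (m # u) @ (Suc m # v @ [m])) ([] @ (u @ [m]) @ (Suc m # v @ [m]))"
    by (rule tl_reduces_context, rule tl_reduces_commute) (use assms sub in auto)
  have 2: "tl_reduces TYPE('a) p 0 ((u @ [m, Suc m]) @ (v @ [m]) @ []) ((u @ [m, Suc m]) @ (m # v) @ [])"
  proof (rule tl_reduces_context)
    have "tl_reduces TYPE('a) p 0 (m # v) (v @ [m])" by (rule tl_reduces_commute) (use assms sub in auto)
    thus "tl_reduces TYPE('a) p 0 (v @ [m]) (m # v)" by (simp add: tl_reduces_def)
  qed
  have 3: "tl_reduces TYPE('a) p 0 (u @ [m, Suc m, m] @ v) (u @ [m] @ v)"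
    by (rule tl_reduces_context) (use assms m in \<open>simp add: tl_reduces_def tl_gen_braid\<close>)
  have "tl_reduces TYPE('a) p 0 ([m] @ s @ [m]) (u @ [m] @ v)"
    using tl_reduces_trans0[OF 1 [simplified] tl_reduces_trans0[OF 2 [simplified] 3 [simplified]]]
    by (simp add: s)
  thus ?thesis using assms m sub
    by (intro exI[of _ 0] exI[of _ "u @ [m] @ v"]) (auto simp: count_notin)
qed

text \<open>
  The normal form behind the Markov trace.  The outer induction makes \<open>m + 1\<close> occur at most
  once between two consecutive occurrences of \<open>m\<close>, which can then be merged.
\<close>

lemma tl_reduces_at_most_one:
  assumes "1 \<le> m" "set w \<subseteq> {m..<p}"
  shows "\<exists>c w'. tl_reduces TYPE('a::field) p c w w' \<and> set w' \<subseteq> {m..<p} \<and> count_list w' m \<le> 1"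
  using assms
proof (induction "p - m" arbitrary: m w)
  case 0
  hence "w = []" by simp
  thus ?case by (intro exI[of _ 0] exI[of _ "[]"]) (simp add: tl_reduces_refl)
next
  case (Suc k)
  note outer = Suc
  show ?case using Suc.prems(2)
  proof (induction "count_list w m" arbitrary: w rule: less_induct)
    case less
    show ?case
    proof (cases "count_list w m \<le> 1")
      case True
      thus ?thesis by (intro exI[of _ 0] exI[of _ w]) (simp add: tl_reduces_refl less.prems)
    next
      case False
      hence "count_list w m \<ge> 2" by simp
      then obtain u s v where w: "w = u @ [m] @ s @ [m] @ v" "m \<notin> set s"
        by (rule count_list_split)
      have mp: "m < p" using outer by simp
      have "set s \<subseteq> {Suc m..<p}" using less.prems w by (intro subset_atLeastLessThan_Suc) auto
      then obtain c1 s1 where s1: "tl_reduces TYPE('a) p c1 s s1" "set s1 \<subseteq> {Suc m..<p}"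
          "count_list s1 (Suc m) \<le> 1"
      proof -
        have "k = p - Suc m" using outer(2) by simp
        from outer(1)[OF this _ \<open>set s \<subseteq> _\<close>] that show thesis by auto
      qed
      obtain c2 s2 where s2: "tl_reduces TYPE('a) p c2 ([m] @ s1 @ [m]) s2"
          "set s2 \<subseteq> {m..<p}" "count_list s2 m = 1"
        using tl_reduces_merge[OF \<open>1 \<le> m\<close> mp s1(2,3)] by blast
      have "tl_reduces TYPE('a) p c1 w (u @ ([m] @ s1 @ [m]) @ v)"
        using tl_reduces_context[OF s1(1), of "u @ [m]" "[m] @ v"] by (simp add: w)
      moreover have "tl_reduces TYPE('a) p c2 (u @ ([m] @ s1 @ [m]) @ v) (u @ s2 @ v)"
        by (rule tl_reduces_context[OF s2(1)])
      ultimately have red: "tl_reduces TYPE('a) p (c1 + c2) w (u @ s2 @ v)"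
        by (rule tl_reduces_trans)
      have "count_list (u @ s2 @ v) m < count_list w m"
        using s2(3) w(2) by (simp add: w(1) count_notin)
      moreover have "set (u @ s2 @ v) \<subseteq> {m..<p}" using less.prems s2(2) by (simp add: w(1))
      ultimately obtain d w' where d: "tl_reduces TYPE('a) p d (u @ s2 @ v) w'"
        and w': "set w' \<subseteq> {m..<p}" "count_list w' m \<le> 1"
        using less.hyps by blast
      show ?thesis
        by (intro exI[of _ "c1 + c2 + d"] exI[of _ w'] conjI tl_reduces_trans[OF red d] w')
    qed
  qed
qed

text \<open>
  The Markov property: the weight \<open>1/a\<close> is the one for which the partial trace of a cup-cap
  pair over the first strand is the identity.
\<close>

lemma qtrace_cup_cap_on_tail:
  assumes "a \<noteq> 0" "linear_op T" "p \<ge> 1"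
  shows "qtrace (inverse a) (Suc p) (\<lambda>f. cup_cap a (on_tail T f)) = qtrace (inverse a) p T"
proof -
  obtain r where p: "p = Suc r" using assms by (cases p) auto
  define R where "R = (\<lambda>b v. inverse a powi ((if b then 1 else -1) + spin v) * T (basis (b # v)) (b # v))"
  have "(\<Sum>v\<in>states r. inverse a powi spin (True # False # v) *
            cup_cap a (on_tail T (basis (True # False # v))) (True # False # v)) = (\<Sum>v\<in>states r. R False v)"
    by (intro sum.cong refl)
      (use assms(1) in \<open>simp add: R_def basis_Cons linear_op_zero[OF assms(2)] power_int_diff divide_inverse mult_ac\<close>)
  moreover have "(\<Sum>v\<in>states r. inverse a powi spin (False # True # v) *
            cup_cap a (on_tail T (basis (False # True # v))) (False # True # v)) = (\<Sum>v\<in>states r. R True v)"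
    by (intro sum.cong refl)
      (use assms(1) in \<open>simp add: R_def basis_Cons linear_op_zero[OF assms(2)] power_int_add\<close>)
  moreover have "qtrace (inverse a) p T = (\<Sum>v\<in>states r. R True v) + (\<Sum>v\<in>states r. R False v)"
    by (simp add: qtrace_def p sum_states_Suc R_def)
  ultimately show ?thesis
    unfolding qtrace_def p sum_states_Suc by simp
qed

text \<open>
  If the letter 1 is absent, the first strand closes to a circle and can be split off; if it
  occurs once, cyclicity brings it to the front and the Markov property removes it together
  with the first strand.
\<close>

lemma qtrace_tl_word_eq_power:
  assumes "set w \<subseteq> {1..<p}"
  shows "\<exists>c. \<forall>a::'a::field. a \<noteq> 0 \<longrightarrow> qtrace (inverse a) p (tl_word a w) = (a + inverse a) ^ c"
  using assms
proof (induction p arbitrary: w)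
  case 0
  thus ?case by (auto simp: qtrace_def basis_def intro!: exI[of _ 0])
next
  case (Suc p)
  obtain c w' where w': "tl_reduces TYPE('a) (Suc p) c w w'" "set w' \<subseteq> {1..<Suc p}" "count_list w' 1 \<le> 1"
    using tl_reduces_at_most_one[of 1 w "Suc p"] Suc.prems by auto
  have red: "qtrace (inverse a) (Suc p) (tl_word a w) =
      (a + inverse a) ^ c * qtrace (inverse a) (Suc p) (tl_word a w')" if "a \<noteq> 0" for a :: 'a
    using w'(1) that unfolding qtrace_def sum_distrib_left
    by (intro sum.cong) (auto simp: tl_reduces_def states_def)
  have no1: "set u \<subseteq> {2..<Suc p}" if "set u \<subseteq> {1..<Suc p}" "1 \<notin> set u" for u
    using subset_atLeastLessThan_Suc[OF that] by (simp add: numeral_2_eq_2)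
  have shifted: "\<exists>v. u = map Suc v \<and> set v \<subseteq> {1..<p}" if "set u \<subseteq> {2..<Suc p}" for u
  proof (intro exI[of _ "map (\<lambda>i. i - 1) u"] conjI)
    have "map Suc (map (\<lambda>i. i - 1) u) = map id u" unfolding map_map
      by (rule map_cong) (use that in auto)
    thus "u = map Suc (map (\<lambda>i. i - 1) u)" by simp
    show "set (map (\<lambda>i. i - 1) u) \<subseteq> {1..<p}"
    proof
      fix j assume "j \<in> set (map (\<lambda>i. i - 1) u)"
      then obtain i where "i \<in> set u" "j = i - 1" by auto
      thus "j \<in> {1..<p}" using subsetD[OF that, of i] by auto
    qed
  qed
  show ?case
  proof (cases "1 \<in> set w'")
    case False
    hence "set w' \<subseteq> {2..<Suc p}" using w'(2) by (rule no1[rotated])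
    then obtain v where v: "w' = map Suc v" "set v \<subseteq> {1..<p}" using shifted by blast
    obtain d where d: "\<And>a::'a. a \<noteq> 0 \<Longrightarrow> qtrace (inverse a) p (tl_word a v) = (a + inverse a) ^ d"
      using Suc.IH[OF v(2)] by blast
    have "qtrace (inverse a) (Suc p) (tl_word a w') = (a + inverse a) ^ Suc d" if "a \<noteq> 0" for a :: 'a
    proof -
      have "qtrace (inverse a) (Suc p) (tl_word a w') = qtrace (inverse a) (Suc p) (on_tail (tl_word a v))"
        by (rule qtrace_same) (use v in \<open>auto simp: same_on_def intro!: tl_word_map_Suc\<close>)
      also have "\<dots> = (a + inverse a) ^ Suc d"
        using that d[OF that] by (simp add: qtrace_on_tail linear_op_tl_word add.commute)
      finally show ?thesis .
    qed
    thus ?thesis using red by (intro exI[of _ "c + Suc d"]) (simp add: power_add)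
  next
    case True
    then obtain s t where st: "w' = s @ 1 # t" "1 \<notin> set s" by (meson split_list_first)
    hence "count_list t 1 = 0" using w'(3) by (simp add: count_list_append)
    hence "1 \<notin> set t" by (simp add: count_list_0_iff)
    hence "set (t @ s) \<subseteq> {2..<Suc p}" using w'(2) st by (intro no1) auto
    then obtain v where v: "t @ s = map Suc v" "set v \<subseteq> {1..<p}" using shifted by blast
    have p: "p \<ge> 1" using w'(2) st by auto
    obtain d where d: "\<And>a::'a. a \<noteq> 0 \<Longrightarrow> qtrace (inverse a) p (tl_word a v) = (a + inverse a) ^ d"
      using Suc.IH[OF v(2)] by blast
    have "qtrace (inverse a) (Suc p) (tl_word a w') = (a + inverse a) ^ d" if "a \<noteq> 0" for a :: 'a
    proof -
      have "qtrace (inverse a) (Suc p) (tl_word a w')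
          = qtrace (inverse a) (Suc p) (\<lambda>f. tl_word a s (tl_word a (1 # t) f))"
        by (simp add: st tl_word_append)
      also have "\<dots> = inverse a powi 0 * qtrace (inverse a) (Suc p) (\<lambda>f. tl_word a (1 # t) (tl_word a s f))"
        using that by (intro qtrace_commute) (auto simp: shifts_spin_tl_word linear_op_tl_word simp del: tl_word.simps)
      also have "\<dots> = qtrace (inverse a) (Suc p) (\<lambda>f. cup_cap a (tl_word a (map Suc v) f))"
        by (simp add: v(1)[symmetric] tl_word_append)
      also have "\<dots> = qtrace (inverse a) (Suc p) (\<lambda>f. cup_cap a (on_tail (tl_word a v) f))"
        by (rule qtrace_same)
          (use v in \<open>auto simp: same_on_def intro!: tl_word_map_Suc linear_op_cong[OF linear_op_cup_cap]\<close>)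
      also have "\<dots> = (a + inverse a) ^ d"
        using that d[OF that] p by (simp add: qtrace_cup_cap_on_tail linear_op_tl_word)
      finally show ?thesis .
    qed
    thus ?thesis using red by (intro exI[of _ "c + d"]) (simp add: power_add)
  qed
qed

section \<open>The trace of a word counts the circles of its closure\<close>

text \<open>
  A subset without arcs to its complement is a union of connected components, so the number of
  such subsets is 2 to the number of components.
\<close>

lemma card_saturated_subsets:
  assumes fin: "finite V" and R: "R \<subseteq> V \<times> V"
  shows "card {S. S \<subseteq> V \<and> (\<forall>(u, v)\<in>R. u \<in> S \<longleftrightarrow> v \<in> S)} = 2 ^ card (V // (R \<union> R\<inverse>)\<^sup>*)"
proof -
  define r where "r = (R \<union> R\<inverse>)\<^sup>*"
  have equiv: "equiv UNIV r"
    by (auto simp: r_def equiv_def refl_on_def trans_def sym_Un_converse sym_rtrancl)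
  have inV: "v \<in> V" if "(u, v) \<in> r" "u \<in> V" for u v
    using that unfolding r_def by (induction rule: rtrancl_induct) (use R in auto)
  have sat: "u \<in> S \<longleftrightarrow> v \<in> S" if "(u, v) \<in> r" "\<forall>(u, v)\<in>R. u \<in> S \<longleftrightarrow> v \<in> S" for u v S
    using that unfolding r_def by (induction rule: rtrancl_induct) auto
  have class_union: "r `` {u} \<in> X" if "u \<in> \<Union>X" "X \<subseteq> V // r" for u X
  proof -
    from that obtain c where c: "u \<in> c" "c \<in> X" "c \<in> V // r" by auto
    then obtain v where "c = r `` {v}" by (auto elim: quotientE)
    hence "c = r `` {u}" using c(1) equiv_class_eq[OF equiv] by auto
    thus ?thesis using c by simp
  qed
  have refl: "u \<in> r `` {u}" for u by (simp add: r_def)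
  have "bij_betw \<Union> (Pow (V // r)) {S. S \<subseteq> V \<and> (\<forall>(u, v)\<in>R. u \<in> S \<longleftrightarrow> v \<in> S)}"
  proof (rule bij_betw_byWitness[where f' = "\<lambda>S. (\<lambda>u. r `` {u}) ` S"])
    show "\<forall>X\<in>Pow (V // r). (\<lambda>u. r `` {u}) ` \<Union> X = X"
    proof (intro ballI equalityI subsetI)
      fix X c assume X: "X \<in> Pow (V // r)" and c: "c \<in> X"
      then obtain v where v: "c = r `` {v}" by (auto elim: quotientE)
      hence "v \<in> \<Union>X" using c refl by auto
      thus "c \<in> (\<lambda>u. r `` {u}) ` \<Union> X" using v by auto
    qed (use class_union in auto)
    show "\<forall>S\<in>{S. S \<subseteq> V \<and> (\<forall>(u, v)\<in>R. u \<in> S \<longleftrightarrow> v \<in> S)}. \<Union> ((\<lambda>u. r `` {u}) ` S) = S"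
    proof (intro ballI equalityI subsetI)
      fix S u assume "S \<in> {S. S \<subseteq> V \<and> (\<forall>(u, v)\<in>R. u \<in> S \<longleftrightarrow> v \<in> S)}" "u \<in> \<Union> ((\<lambda>u. r `` {u}) ` S)"
      thus "u \<in> S" using sat[of _ u S] by blast
    qed (use refl in auto)
    show "\<Union> ` Pow (V // r) \<subseteq> {S. S \<subseteq> V \<and> (\<forall>(u, v)\<in>R. u \<in> S \<longleftrightarrow> v \<in> S)}"
    proof clarsimp
      fix X assume X: "X \<subseteq> V // r"
      have 1: "v \<in> \<Union>X" if "u \<in> \<Union>X" "(u, v) \<in> r" for u v
        using class_union[OF that(1) X] that(2) by auto
      have "\<Union>X \<subseteq> V" using X inV by (force elim: quotientE)
      moreover have "(\<exists>c\<in>X. u \<in> c) = (\<exists>c\<in>X. v \<in> c)" if "(u, v) \<in> R" for u v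
      proof -
        have "(u, v) \<in> r" "(v, u) \<in> r" using that by (auto simp: r_def)
        thus ?thesis using 1[of u v] 1[of v u] by auto
      qed
      ultimately show "\<Union>X \<subseteq> V \<and> (\<forall>x\<in>R. case x of (u, v) \<Rightarrow> (\<exists>c\<in>X. u \<in> c) = (\<exists>c\<in>X. v \<in> c))"
        by (intro conjI ballI) (clarify, blast)+
    qed
    show "(\<lambda>S. (\<lambda>u. r `` {u}) ` S) ` {S. S \<subseteq> V \<and> (\<forall>(u, v)\<in>R. u \<in> S \<longleftrightarrow> v \<in> S)} \<subseteq> Pow (V // r)"
      by (auto intro: quotientI)
  qed
  from bij_betw_same_card[OF this] show ?thesis
    using fin by (simp add: card_Pow finite_quotient r_def quotient_def)
qed

text \<open>
  The nonzero entries of the cup-cap matrix.  For \<open>a = 1\<close> they are all equal to 1, so that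
  traces of words count closed paths of states.
\<close>

definition cup_cap_step :: "nat \<Rightarrow> bool list \<Rightarrow> bool list \<Rightarrow> bool" where
  "cup_cap_step i x y \<longleftrightarrow> x ! (i - 1) \<noteq> x ! i \<and> y ! (i - 1) \<noteq> y ! i \<and>
     (\<forall>k\<in>{1..length x}. k \<noteq> i \<and> k \<noteq> Suc i \<longrightarrow> x ! (k - 1) = y ! (k - 1))"

lemma cup_cap_step_Cons:
  assumes "1 \<le> i"
  shows "cup_cap_step (Suc i) (b # x) (c # y) \<longleftrightarrow> b = c \<and> cup_cap_step i x y"
proof -
  have "(\<forall>k\<in>{1..Suc n}. P k) \<longleftrightarrow> P 1 \<and> (\<forall>k\<in>{1..n}. P (Suc k))" for n P
  proof -
    have "{1..Suc n} = insert 1 {Suc 1..Suc n}" by auto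
    also have "{Suc 1..Suc n} = Suc ` {1..n}" by (rule image_Suc_atLeastAtMost[symmetric])
    finally show ?thesis by (simp del: image_Suc_atLeastAtMost)
  qed
  thus ?thesis using assms by (auto simp: cup_cap_step_def nth_Cons')
qed

lemma tl_gen_one_basis:
  assumes "1 \<le> i" "i < length x" "length y = length x"
  shows "tl_gen (1::'a::field) i (basis y) x = of_bool (cup_cap_step i x y)"
  using assms
proof (induction i arbitrary: x y rule: nat_induct_at_least)
  case base
  then obtain b c v where x: "x = b # c # v" by (metis One_nat_def Suc_le_length_iff Suc_le_eq less_Suc_eq_0_disj length_Suc_conv list.exhaust list.size(3) not_less_zero)
  with base obtain b' c' v' where y: "y = b' # c' # v'" "length v' = length v"
    by (auto simp: length_Suc_conv)
  have "(\<forall>k\<in>{Suc 0..Suc (Suc (length v))}. k \<noteq> Suc 0 \<and> k \<noteq> Suc (Suc 0) \<longrightarrow>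
           (b # c # v) ! (k - Suc 0) = (b' # c' # v') ! (k - Suc 0)) \<longleftrightarrow> v = v'" (is "?L \<longleftrightarrow> _")
  proof
    assume L: ?L
    show "v = v'"
    proof (rule nth_equalityI)
      fix j assume "j < length v"
      thus "v ! j = v' ! j" using L[rule_format, of "Suc (Suc (Suc j))"] by simp
    qed (simp add: y)
  next
    assume "v = v'" thus ?L by (auto simp: nth_Cons')
  qed
  thus ?case by (auto simp: x y basis_def cup_cap_step_def)
next
  case (Suc i)
  then obtain b v where x: "x = b # v" by (cases x) auto
  with Suc obtain b' v' where y: "y = b' # v'" by (cases y) auto
  have "tl_gen (1::'a) (Suc i) (basis y) x = tl_gen 1 i (\<lambda>w. basis (b' # v') (b # w)) v"
    using Suc.hyps by (simp add: x y tl_gen_Suc)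
  thus ?case using Suc by (auto simp: x y basis_Cons cup_cap_step_Cons linear_op_zero[OF linear_op_tl_gen])
qed

definition state_paths :: "nat \<Rightarrow> nat list \<Rightarrow> bool list list set" where
  "state_paths p w = {xs. length xs = Suc (length w) \<and> set xs \<subseteq> states p \<and>
     (\<forall>j<length w. cup_cap_step (w ! j) (xs ! j) (xs ! Suc j))}"

lemma finite_state_paths: "finite (state_paths p w)"
  by (rule finite_subset[OF _ finite_lists_length_eq[OF finite_states, of p "Suc (length w)"]])
    (auto simp: state_paths_def)

lemma state_paths_Cons:
  "x # xs \<in> state_paths p (i # w) \<longleftrightarrow>
     x \<in> states p \<and> xs \<in> state_paths p w \<and> cup_cap_step i x (hd xs)"
  by (cases xs) (auto simp: state_paths_def less_Suc_eq_0_disj)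

lemma tl_word_one_basis:
  assumes "set w \<subseteq> {1..<p}" "x \<in> states p" "y \<in> states p"
  shows "tl_word (1::'a::field) w (basis y) x =
    of_nat (card {xs \<in> state_paths p w. hd xs = x \<and> last xs = y})"
  using assms
proof (induction w arbitrary: x)
  case Nil
  hence "{xs \<in> state_paths p []. hd xs = x \<and> last xs = y} = (if x = y then {[x]} else {})"
    by (auto simp: state_paths_def length_Suc_conv)
  thus ?case by (simp add: basis_def)
next
  case (Cons i w)
  let ?P = "\<lambda>z. {xs \<in> state_paths p w. hd xs = z \<and> last xs = y}"
  let ?Z = "{z \<in> states p. cup_cap_step i x z}"
  have "{xs \<in> state_paths p (i # w). hd xs = x \<and> last xs = y} = (#) x ` (\<Union>z\<in>?Z. ?P z)" (is "?L = ?R")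
  proof (intro equalityI subsetI)
    fix xs assume xs: "xs \<in> ?L"
    then obtain xs' where "xs = x # xs'" by (cases xs) (auto simp: state_paths_def)
    moreover have "hd zs \<in> states p" "zs \<noteq> []" if "zs \<in> state_paths p w" for zs
      using that by (cases zs; auto simp: state_paths_def)+
    ultimately show "xs \<in> ?R" using xs by (auto simp: state_paths_Cons)
  next
    fix xs assume "xs \<in> ?R"
    moreover have "zs \<noteq> []" if "zs \<in> state_paths p w" for zs
      using that by (cases zs; auto simp: state_paths_def)
    ultimately show "xs \<in> ?L" using Cons.prems by (auto simp: state_paths_Cons)
  qed
  hence "card {xs \<in> state_paths p (i # w). hd xs = x \<and> last xs = y} = card (\<Union>z\<in>?Z. ?P z)"
    by (simp add: card_image)
  also have "\<dots> = (\<Sum>z\<in>?Z. card (?P z))"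
    by (rule card_UN_disjoint) (auto simp: finite_state_paths)
  finally have card: "card {xs \<in> state_paths p (i # w). hd xs = x \<and> last xs = y} = (\<Sum>z\<in>?Z. card (?P z))" .
  have "tl_word (1::'a) (i # w) (basis y) x = (\<Sum>z\<in>states p. tl_word 1 w (basis y) z * tl_gen 1 i (basis z) x)"
    using Cons.prems by (simp, subst linear_op_expand[OF linear_op_tl_gen]) (simp add: states_def)
  also have "\<dots> = (\<Sum>z\<in>states p. if cup_cap_step i x z then of_nat (card (?P z)) else 0)"
    using Cons by (intro sum.cong refl) (auto simp: states_def tl_gen_one_basis)
  also have "\<dots> = (\<Sum>z\<in>?Z. of_nat (card (?P z)))"
    by (simp add: sum.inter_filter)
  finally show ?case by (simp add: card)
qed

lemma qtrace_one_tl_word: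
  assumes "set w \<subseteq> {1..<p}"
  shows "qtrace 1 p (tl_word (1::'a::field) w) = of_nat (card {xs \<in> state_paths p w. hd xs = last xs})"
proof -
  have hd: "hd xs \<in> states p" if "xs \<in> state_paths p w" for xs
    using that by (cases xs) (auto simp: state_paths_def)
  have "{xs \<in> state_paths p w. hd xs = last xs} = (\<Union>x\<in>states p. {xs \<in> state_paths p w. hd xs = x \<and> last xs = x})"
    using hd by fastforce
  also have "card \<dots> = (\<Sum>x\<in>states p. card {xs \<in> state_paths p w. hd xs = x \<and> last xs = x})"
    by (rule card_UN_disjoint) (auto simp: finite_state_paths)
  finally show ?thesis using assms by (simp add: qtrace_def tl_word_one_basis)
qed

text \<open>
  A cup or cap joins neighbouring positions and forces opposite spins there.  Flipping the spins
  at all even positions turns this into equality, and the points with spin up then form a set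
  without arcs to its complement.
\<close>

lemma card_closed_state_paths:
  assumes "set w \<subseteq> {1..<p}"
  shows "card {xs \<in> state_paths p w. hd xs = last xs} = 2 ^ num_circles p w"
proof -
  let ?n = "length w" and ?V = "{1..p} \<times> {0..length w}"
  let ?Sat = "{S. S \<subseteq> ?V \<and> (\<forall>(u, v)\<in>closure_arcs p w. u \<in> S \<longleftrightarrow> v \<in> S)}"
  let ?Q = "{xs \<in> state_paths p w. hd xs = last xs}"
  \<comment> \<open>the flip at even positions, and its inverse\<close>
  define dom where "dom = (\<lambda>xs :: bool list list. {(i, j) \<in> ?V. xs ! j ! (i - 1) \<noteq> even i})"
  define lab where "lab = (\<lambda>S. map (\<lambda>j. map (\<lambda>i. ((Suc i, j) \<in> S) \<noteq> even (Suc i)) [0..<p]) [0..<Suc ?n])"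
  have w: "w ! j \<ge> 1" "w ! j < p" "Suc (w ! j) \<le> p" if "j < ?n" for j
    using subsetD[OF assms nth_mem[OF that]] by auto
  have arcs: "closure_arcs p w \<subseteq> ?V \<times> ?V"
    unfolding closure_arcs_def using w by (auto simp: less_imp_le)
  have lab_nth: "lab S ! j ! (i - 1) = (((i, j) \<in> S) \<noteq> even i)" if "i \<in> {1..p}" "j \<le> ?n" for S i j
    using that by (auto simp: lab_def less_Suc_eq_le simp del: upt_Suc)
  have len: "length (xs ! j) = p" if "xs \<in> state_paths p w" "j \<le> ?n" for xs j
  proof -
    have "xs ! j \<in> set xs" using that by (intro nth_mem) (simp add: state_paths_def)
    moreover have "set xs \<subseteq> states p" using that by (simp add: state_paths_def)
    ultimately have "xs ! j \<in> states p" by (rule rev_subsetD)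
    thus ?thesis by (simp add: states_def)
  qed
  have "bij_betw dom ?Q ?Sat"
  proof (rule bij_betw_byWitness[where f' = lab])
    show "\<forall>xs\<in>?Q. lab (dom xs) = xs"
    proof
      fix xs assume "xs \<in> ?Q"
      hence xs: "xs \<in> state_paths p w" by simp
      show "lab (dom xs) = xs"
      proof (rule nth_equalityI)
        show "length (lab (dom xs)) = length xs" using xs by (simp add: lab_def state_paths_def)
        fix j assume "j < length (lab (dom xs))"
        hence j: "j \<le> ?n" by (simp add: lab_def)
        show "lab (dom xs) ! j = xs ! j"
        proof (rule nth_equalityI)
          show l: "length (lab (dom xs) ! j) = length (xs ! j)"
            using j len[OF xs j] by (simp add: lab_def less_Suc_eq_le del: upt_Suc)
          fix i assume "i < length (lab (dom xs) ! j)"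
          hence "Suc i \<in> {1..p}" using l len[OF xs j] by simp
          thus "lab (dom xs) ! j ! i = xs ! j ! i"
            using lab_nth[of "Suc i" j "dom xs"] j by (auto simp: dom_def)
        qed
      qed
    qed
    show "\<forall>S\<in>?Sat. dom (lab S) = S"
    proof
      fix S assume "S \<in> ?Sat"
      hence "S \<subseteq> ?V" by simp
      moreover have "dom (lab S) = {(i, j) \<in> ?V. (i, j) \<in> S}"
        unfolding dom_def by (rule Collect_cong) (clarify, use lab_nth[of _ _ S] in force)
      ultimately show "dom (lab S) = S" by auto
    qed
    show "dom ` ?Q \<subseteq> ?Sat"
    proof
      fix S assume "S \<in> dom ` ?Q"
      then obtain xs where xs: "xs \<in> state_paths p w" "hd xs = last xs" and S: "S = dom xs" by auto
      have step: "cup_cap_step (w ! j) (xs ! j) (xs ! Suc j)" if "j < ?n" for j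
        using xs that by (simp add: state_paths_def)
      have close: "xs ! 0 = xs ! ?n"
      proof -
        have "length xs = Suc ?n" using xs(1) by (simp add: state_paths_def)
        moreover from this have "xs \<noteq> []" by auto
        ultimately show ?thesis using xs(2) by (simp add: last_conv_nth hd_conv_nth)
      qed
      have "u \<in> S \<longleftrightarrow> v \<in> S" if "(u, v) \<in> closure_arcs p w" for u v
        using that unfolding closure_arcs_def
      proof (elim UnE)
        assume "(u, v) \<in> {((x, j), x, Suc j) |x j. x \<in> {1..p} \<and> j < ?n \<and> x \<noteq> w ! j \<and> x \<noteq> Suc (w ! j)}"
        then obtain x j where *: "u = (x, j)" "v = (x, Suc j)" "x \<in> {1..p}" "j < ?n"
            "x \<noteq> w ! j" "x \<noteq> Suc (w ! j)" by auto
        have "xs ! j ! (x - 1) = xs ! Suc j ! (x - 1)"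
          using step[OF *(4)] * len[OF xs(1), of j] by (simp add: cup_cap_step_def)
        thus ?thesis using * by (auto simp: S dom_def)
      next
        assume "(u, v) \<in> {((w ! j, j), Suc (w ! j), j) |j. j < ?n}"
        then obtain j where *: "u = (w ! j, j)" "v = (Suc (w ! j), j)" "j < ?n" by auto
        thus ?thesis using step[OF *(3)] w[OF *(3)] by (auto simp: S dom_def cup_cap_step_def)
      next
        assume "(u, v) \<in> {((w ! j, Suc j), Suc (w ! j), Suc j) |j. j < ?n}"
        then obtain j where *: "u = (w ! j, Suc j)" "v = (Suc (w ! j), Suc j)" "j < ?n" by auto
        thus ?thesis using step[OF *(3)] w[OF *(3)] by (auto simp: S dom_def cup_cap_step_def)
      next
        assume "(u, v) \<in> {((x, ?n), x, 0) |x. x \<in> {1..p}}"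
        thus ?thesis using close by (auto simp: S dom_def)
      qed
      hence "\<forall>(u, v)\<in>closure_arcs p w. u \<in> S \<longleftrightarrow> v \<in> S" by (intro ballI) (clarify, blast)
      moreover have "S \<subseteq> ?V" unfolding S dom_def by auto
      ultimately show "S \<in> ?Sat" by simp
    qed
    show "lab ` ?Sat \<subseteq> ?Q"
    proof
      fix xs assume "xs \<in> lab ` ?Sat"
      then obtain S where Sat: "S \<in> ?Sat" and xs: "xs = lab S" by blast
      have S: "u \<in> S \<longleftrightarrow> v \<in> S" if "(u, v) \<in> closure_arcs p w" for u v
        using Sat that by blast
      have "cup_cap_step (w ! j) (xs ! j) (xs ! Suc j)" if j: "j < ?n" for j
      proof -
        have i: "w ! j \<in> {1..p}" "Suc (w ! j) \<in> {1..p}" using w[OF j] by auto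
        have 1: "((w ! j, j), Suc (w ! j), j) \<in> closure_arcs p w"
            "((w ! j, Suc j), Suc (w ! j), Suc j) \<in> closure_arcs p w"
          using j unfolding closure_arcs_def by auto
        have 2: "((k, j), k, Suc j) \<in> closure_arcs p w" if "k \<in> {1..p}" "k \<noteq> w ! j" "k \<noteq> Suc (w ! j)" for k
          using j that by (simp add: closure_arcs_def)
        have len: "length (lab S ! j) = p" using j by (simp add: lab_def del: upt_Suc)
        have "lab S ! j ! (w ! j - 1) \<noteq> lab S ! j ! (w ! j)"
          using lab_nth[OF i(1), of j S] lab_nth[OF i(2), of j S] S[OF 1(1)] j by simp
        moreover have "lab S ! Suc j ! (w ! j - 1) \<noteq> lab S ! Suc j ! (w ! j)"
          using lab_nth[OF i(1), of "Suc j" S] lab_nth[OF i(2), of "Suc j" S] S[OF 1(2)] j by simp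
        moreover have "lab S ! j ! (k - 1) = lab S ! Suc j ! (k - 1)"
          if "k \<in> {1..p}" "k \<noteq> w ! j" "k \<noteq> Suc (w ! j)" for k
          using lab_nth[OF that(1), of j S] lab_nth[OF that(1), of "Suc j" S] S[OF 2[OF that]] j by simp
        ultimately show ?thesis unfolding cup_cap_step_def xs len by blast
      qed
      moreover have "set xs \<subseteq> states p" "length xs = Suc ?n" by (auto simp: xs lab_def states_def)
      moreover have "lab S ! 0 = lab S ! ?n"
      proof -
        have "((i, ?n), i, 0) \<in> closure_arcs p w" if "i \<in> {1..p}" for i
          using that unfolding closure_arcs_def by auto
        hence "(i, 0) \<in> S \<longleftrightarrow> (i, ?n) \<in> S" if "i \<in> {1..p}" for i using S that by blast
        thus ?thesis by (auto simp: lab_def simp del: upt_Suc)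
      qed
      hence "hd xs = last xs"
        by (simp add: xs hd_conv_nth last_conv_nth lab_def del: upt_Suc)
      ultimately show "xs \<in> ?Q" by (simp add: state_paths_def)
    qed
  qed
  from bij_betw_same_card[OF this] show ?thesis
    using card_saturated_subsets[OF _ arcs] by (simp add: num_circles_def)
qed

text \<open>
  The trace is a power of the value of a circle, with an exponent independent of \<open>a\<close>; at
  \<open>a = 1\<close> a circle has value 2 and the exponent can be read off in characteristic 0.
\<close>

theorem qtrace_tl_word:
  assumes "set w \<subseteq> {1..<p}" "(a::'a::field_char_0) \<noteq> 0"
  shows "qtrace (inverse a) p (tl_word a w) = (a + inverse a) ^ num_circles p w"
proof -
  obtain c where c: "\<And>a::'a. a \<noteq> 0 \<Longrightarrow> qtrace (inverse a) p (tl_word a w) = (a + inverse a) ^ c"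
    using qtrace_tl_word_eq_power[OF assms(1)] by blast
  have "(of_nat (2 ^ c) :: 'a) = of_nat (2 ^ num_circles p w)"
    using c[of 1] card_closed_state_paths[OF assms(1)] qtrace_one_tl_word[OF assms(1), where 'a = 'a]
    by (simp add: one_add_one)
  hence "(2::nat) ^ c = 2 ^ num_circles p w" by (simp only: of_nat_eq_iff)
  hence "c = num_circles p w" by simp
  thus ?thesis using c assms(2) by simp
qed

section \<open>The Kauffman bracket as a trace\<close>

fun crossing_index :: "crossing \<Rightarrow> nat" where
  "crossing_index (Sigma i) = i"
| "crossing_index (SigmaInv i) = i"

fun crossing_op :: "'a::field \<Rightarrow> crossing \<Rightarrow> 'a operator" where
  "crossing_op A (Sigma i) = (\<lambda>f x. A * f x + inverse A * tl_gen (- A\<^sup>2) i f x)"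
| "crossing_op A (SigmaInv i) = (\<lambda>f x. inverse A * f x + A * tl_gen (- A\<^sup>2) i f x)"

fun braid_op :: "'a::field \<Rightarrow> crossing list \<Rightarrow> 'a operator" where
  "braid_op A [] = (\<lambda>f. f)"
| "braid_op A (c # w) = (\<lambda>f. crossing_op A c (braid_op A w f))"

lemma linear_op_crossing_op: "linear_op (crossing_op A c)"
  by (cases c) (auto intro: linear_op_lincomb linear_op_tl_gen)

lemma linear_op_braid_op: "linear_op (braid_op A w)"
  by (induction w) (auto intro: linear_op_comp linear_op_crossing_op)

lemma braid_op_append: "braid_op A (u @ v) = (\<lambda>f. braid_op A u (braid_op A v f))"
  by (induction u) auto

text \<open>
  With \<open>a = - A\<^sup>2\<close> the value of a circle is \<open>- A\<^sup>2 - A\<^sup>-\<^sup>2\<close>.  It appears as a factor because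
  the bracket of one circle is 1 and not the value of a circle.
\<close>

lemma resolve_eq_qtrace:
  fixes A :: "'a::field_char_0"
  assumes "A \<noteq> 0" "p \<ge> 1" "set es \<subseteq> {1..<p}" "crossing_index ` set w \<subseteq> {1..<p}"
  shows "(- (A powi 2) - A powi (-2)) * resolve A p es w =
    qtrace (- (A powi (-2))) p (\<lambda>f. tl_word (- A\<^sup>2) es (braid_op A w f))"
  using assms(3,4)
proof (induction w arbitrary: es)
  case Nil
  have "({1..p} \<times> {0..length es}) // ((closure_arcs p es \<union> (closure_arcs p es)\<inverse>)\<^sup>*) \<noteq> {}"
    using assms(2) by (auto simp: quotient_def)
  hence "num_circles p es \<noteq> 0" by (simp add: num_circles_def quotient_def)
  then obtain c where c: "num_circles p es = Suc c" by (cases "num_circles p es") auto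
  show ?case
    using qtrace_tl_word[OF Nil(1), of "- A\<^sup>2"] assms(1)
    by (simp add: c power_int_minus)
next
  case (Cons x w)
  let ?d = "- (A powi 2) - A powi (-2)" and ?a = "- A\<^sup>2"
  note lin = linear_op_tl_word[of ?a es]
  have expand: "tl_word ?a es (\<lambda>y. c * g y + d * h y) = (\<lambda>y. c * tl_word ?a es g y + d * tl_word ?a es h y)"
    for c d g h by (simp add: linear_op_add[OF lin] linear_op_scale[OF lin] fun_eq_iff)
  show ?case
  proof (cases x)
    case (Sigma i)
    hence i: "set (es @ [i]) \<subseteq> {1..<p}" using Cons.prems by auto
    show ?thesis
      using Cons.IH[OF Cons.prems(1)] Cons.IH[OF i] Cons.prems
      by (simp add: Sigma expand qtrace_lincomb tl_word_append power_int_minus algebra_simps)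
  next
    case (SigmaInv i)
    hence i: "set (es @ [i]) \<subseteq> {1..<p}" using Cons.prems by auto
    show ?thesis
      using Cons.IH[OF Cons.prems(1)] Cons.IH[OF i] Cons.prems
      by (simp add: SigmaInv expand qtrace_lincomb tl_word_append power_int_minus algebra_simps)
  qed
qed

section \<open>The raising operator and the Coxeter braid\<close>

text \<open>
  The sum over all ways of lowering one up spin of the argument, weighted by a power of \<open>A\<close>
  given by the spins to its left.  This is a generator of quantum \<open>sl\<^sub>2\<close> on the tensor power;
  as an operator on functions it raises the spin.
\<close>

fun raise :: "'a::field \<Rightarrow> 'a operator" where
  "raise A f [] = 0"
| "raise A f (b # v) = (if b then f (False # v) + inverse (A\<^sup>2) * raise A (\<lambda>w. f (b # w)) v
                        else A\<^sup>2 * raise A (\<lambda>w. f (b # w)) v)"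

lemma linear_op_raise: "linear_op (raise A)"
proof -
  have "raise A (\<lambda>y. f y + g y) x = raise A f x + raise A g x" for f g x
    by (induction x arbitrary: f g) (auto simp: algebra_simps)
  moreover have "raise A (\<lambda>y. c * f y) x = c * raise A f x" for c f x
    by (induction x arbitrary: f) (auto simp: algebra_simps)
  moreover have "raise A f x = raise A g x" if "\<forall>y. length y = length x \<longrightarrow> f y = g y" for f g x
    using that
  proof (induction x arbitrary: f g)
    case (Cons b x)
    have "raise A (\<lambda>w. f (c # w)) x = raise A (\<lambda>w. g (c # w)) x" for c
      by (rule Cons.IH) (use Cons.prems in auto)
    thus ?case using Cons.prems by auto
  qed simp
  ultimately show ?thesis unfolding linear_op_def by blast
qed

lemma basis_Cons_Cons: "basis (c # y) (b # x) = (if b = c then basis y x else 0)"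
  by (auto simp: basis_def)

lemma raise_basis_spin: "raise A (basis y) x \<noteq> 0 \<Longrightarrow> length x = length y \<Longrightarrow> spin x = spin y + 2"
proof (induction x arbitrary: y)
  case (Cons b x)
  then obtain c w where y: "y = c # w" by (cases y) auto
  show ?case
  proof (cases "b = c")
    case True
    hence "raise A (basis w) x \<noteq> 0" using Cons.prems
      by (cases c) (auto simp: y basis_Cons_Cons)
    thus ?thesis using Cons True by (auto simp: y)
  next
    case False
    thus ?thesis using Cons.prems
      by (cases c) (auto simp: y basis_Cons_Cons basis_def linear_op_zero[OF linear_op_raise] split: if_splits)
  qed
qed simp

lemma shifts_spin_raise: "shifts_spin 2 (raise A)"
  using raise_basis_spin by (auto simp: shifts_spin_def)

lemma raise_snoc:
  assumes "A \<noteq> 0"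
  shows "raise A f (v @ [b]) =
     raise A (\<lambda>w. f (w @ [b])) v + (if b then A powi (-2 * spin v) * f (v @ [False]) else 0)"
proof (induction v arbitrary: f)
  case Nil
  thus ?case by simp
next
  case (Cons c v)
  have "A powi (-2) * A powi (-2 * spin v) = A powi (-2 + -2 * spin v)"
       "A powi 2 * A powi (-2 * spin v) = A powi (2 + -2 * spin v)"
    using assms by (simp_all only: power_int_add simp_thms)
  hence "inverse (A\<^sup>2) * A powi (-2 * spin v) = A powi (-2 * (1 + spin v))"
       "A\<^sup>2 * A powi (-2 * spin v) = A powi (-2 * (-1 + spin v))"
    by (simp_all add: power_int_minus algebra_simps)
  thus ?case using Cons by (auto simp: algebra_simps)
qed

lemma raise_on_tail:
  assumes "linear_op T" "\<And>f x. raise A (T f) x = T (raise A f) x"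
  shows "raise A (on_tail T f) x = on_tail T (raise A f) x"
  by (cases x) (auto simp: assms(2) linear_op_add[OF assms(1)] linear_op_scale[OF assms(1)])

text \<open>
  Lowering either spin of an up-up pair gives two contributions that cancel after the cup-cap
  pair is applied.  Likewise the cup-cap pair annihilates what arises from up-down and from
  down-up by lowering their up spins, both of which lead to down-down.
\<close>

lemma raise_cup_cap:
  assumes "a \<noteq> 0" "A\<^sup>2 = - a"
  shows "raise A (cup_cap a f) x = cup_cap a (raise A f) x"
proof (cases "(a, f, x)" rule: cup_cap.cases)
  case (1 a g b c v)
  note lin = linear_op_raise[of A]
  show ?thesis
    using 1 assms
    by (cases b; cases c)
      (simp_all add: linear_op_add[OF lin] linear_op_scale[OF lin] linear_op_zero[OF lin] distrib_left distrib_right mult.assoc[symmetric],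
        simp_all add: field_simps)
qed auto

lemma raise_tl_gen:
  assumes "A \<noteq> 0"
  shows "raise A (tl_gen (- A\<^sup>2) i f) x = tl_gen (- A\<^sup>2) i (raise A f) x"
  using assms
proof (induction "- A\<^sup>2" i arbitrary: f x rule: tl_gen.induct)
  case (3 i)
  show ?case using 3 by (simp add: raise_on_tail linear_op_tl_gen)
qed (auto simp: linear_op_zero[OF linear_op_raise] intro!: raise_cup_cap)

lemma raise_crossing_op:
  assumes "A \<noteq> 0"
  shows "raise A (crossing_op A c f) x = crossing_op A c (raise A f) x"
  by (cases c)
    (simp_all add: linear_op_add[OF linear_op_raise] linear_op_scale[OF linear_op_raise] raise_tl_gen[OF assms])

lemma raise_braid_op:
  assumes "A \<noteq> 0"
  shows "raise A (braid_op A w f) = braid_op A w (raise A f)"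
proof (induction w)
  case (Cons c w)
  show ?case by (simp add: Cons[symmetric]) (rule ext, rule raise_crossing_op[OF assms])
qed simp

definition coxeter :: "nat \<Rightarrow> crossing list" where
  "coxeter p = map Sigma [1..<p]"

lemma braid_op_map_Sigma_Suc:
  "set w \<subseteq> {1..} \<Longrightarrow> braid_op A (map Sigma (map Suc w)) f (b # v) = braid_op A (map Sigma w) (\<lambda>u. f (b # u)) v"
proof (induction w arbitrary: f b v)
  case (Cons i w)
  have "(\<lambda>u. braid_op A (map Sigma (map Suc w)) f (b # u)) = braid_op A (map Sigma w) (\<lambda>u. f (b # u))"
    using Cons by (auto simp: fun_eq_iff)
  thus ?case using Cons.prems by (simp add: tl_gen_Suc fun_eq_iff)
qed simp

lemma coxeter_Suc: "p \<ge> 1 \<Longrightarrow> coxeter (Suc p) = Sigma 1 # map Sigma (map Suc [1..<p])"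
  unfolding coxeter_def by (subst upt_conv_Cons) (simp_all add: map_Suc_upt del: upt_Suc)

text \<open>
  The first spin is carried to the end of the list.  An up spin arrives unchanged.  A down spin
  may exchange itself once for an up spin on its way, and the sum over the places where this
  happens is \<open>raise A f (v @ [True])\<close> except for its term that lowers the last spin.  That term
  is what changes the exponent \<open>- spin v\<close> of the undisturbed passage into \<open>- spin v - 4\<close>.
\<close>

lemma braid_op_coxeter:
  assumes "A \<noteq> 0" "length x = Suc n"
  shows "braid_op A (coxeter (Suc n)) f x = (case x of b # v \<Rightarrow>
     if b then A powi spin v * f (v @ [True])
     else A powi (- spin v - 4) * f (v @ [False])
       + (A - A powi (-3)) * A powi (spin v - 1) * raise A f (v @ [True]))"
  using assms(2)
proof (induction n arbitrary: x f)
  case 0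
  then obtain b where "x = [b]" by (auto simp: length_Suc_conv)
  moreover have "A powi (-4) + (A - A powi (-3)) * A powi (-1) = 1"
    using assms(1) by (simp add: power_int_minus field_simps power_numeral_reduce)
  hence "A powi (-4) * t + (A - A powi (-3)) * A powi (-1) * t = t" for t
    by (simp add: distrib_right[symmetric])
  ultimately show ?case by (cases b) (auto simp: coxeter_def)
next
  case (Suc n)
  then obtain b c w where x: "x = b # c # w" by (auto simp: length_Suc_conv)
  define g where "g = (\<lambda>b. braid_op A (coxeter (Suc n)) (\<lambda>u. f (b # u)))"
  define T where "T = map Sigma (map Suc [1..<Suc n])"
  have tail: "braid_op A T f (b # v) = g b v" for b v
    unfolding g_def T_def coxeter_def by (rule braid_op_map_Sigma_Suc) auto
  have cox: "coxeter (Suc (Suc n)) = Sigma 1 # T"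
    unfolding T_def by (rule coxeter_Suc) simp
  have gT: "g b (True # w) = A powi spin w * f (b # w @ [True])"
   and gF: "g b (False # w) = A powi (- spin w - 4) * f (b # w @ [False])
       + (A - A powi (-3)) * A powi (spin w - 1) * raise A (\<lambda>u. f (b # u)) (w @ [True])" for b
    using Suc.IH[of "True # w" "\<lambda>u. f (b # u)"] Suc.IH[of "False # w" "\<lambda>u. f (b # u)"] Suc.prems x
    by (simp_all add: g_def)
  have "braid_op A (coxeter (Suc (Suc n))) f x =
      A * g b (c # w) + inverse A * (if b = c then 0 else
         (if b then 1 else inverse (- A\<^sup>2)) * (- A\<^sup>2 * g True (False # w) + g False (True # w)))"
    unfolding cox x by (simp add: tail)
  also have "\<dots> = (if b = c then A * g b (c # w)
      else if b then inverse A * g False (True # w)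
      else inverse A * g True (False # w) + (A - A powi (-3)) * g False (True # w))"
    using assms(1) by (auto simp: power_int_minus field_simps power2_eq_square power3_eq_cube)
  finally have main: "braid_op A (coxeter (Suc (Suc n))) f x = \<dots>" .
  define s where "s = spin w"
  show ?case
    unfolding main unfolding x
    using assms(1)
    by (cases b; cases c)
      (simp_all add: gT gF s_def[symmetric] power_int_add power_int_diff power_int_minus field_simps,
        simp_all add: eval_nat_numeral field_simps)
qed

text \<open>
  The parameters \<open>(0, -4)\<close> give the rotation contained in the Coxeter braid; commuting it with
  \<open>raise\<close> changes them to \<open>(-4, 0)\<close>.
\<close>

fun twisted_rotation :: "'a::field \<Rightarrow> int \<Rightarrow> int \<Rightarrow> 'a operator" where
  "twisted_rotation A \<alpha> \<beta> f [] = f []"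
| "twisted_rotation A \<alpha> \<beta> f (b # v) =
     (if b then A powi (spin v + \<alpha>) else A powi (- spin v + \<beta>)) * f (v @ [b])"

text \<open>
  What is left of the Coxeter braid after its rotation, with \<open>raise\<close> split off on the right.
\<close>

fun lower :: "'a::field \<Rightarrow> 'a operator" where
  "lower A h [] = 0"
| "lower A h (b # v) = (if b then 0 else (A - A powi (-3)) * A powi (spin v - 1) * h (v @ [True]))"

lemma linear_op_twisted_rotation: "linear_op (twisted_rotation A \<alpha> \<beta>)"
proof -
  have "twisted_rotation A \<alpha> \<beta> (\<lambda>y. f y + g y) x = twisted_rotation A \<alpha> \<beta> f x + twisted_rotation A \<alpha> \<beta> g x" for f g x
    by (cases x) (simp_all add: algebra_simps)
  moreover have "twisted_rotation A \<alpha> \<beta> (\<lambda>y. c * f y) x = c * twisted_rotation A \<alpha> \<beta> f x" for c f x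
    by (cases x) (simp_all add: algebra_simps)
  moreover have "twisted_rotation A \<alpha> \<beta> f x = twisted_rotation A \<alpha> \<beta> g x"
    if "\<forall>y. length y = length x \<longrightarrow> f y = g y" for f g x
    using that by (cases x) auto
  ultimately show ?thesis unfolding linear_op_def by blast
qed

lemma linear_op_lower: "linear_op (lower A)"
proof -
  have "lower A (\<lambda>y. f y + g y) x = lower A f x + lower A g x" for f g x
    by (cases x) (simp_all add: algebra_simps)
  moreover have "lower A (\<lambda>y. c * f y) x = c * lower A f x" for c f x
    by (cases x) (simp_all add: algebra_simps)
  moreover have "lower A f x = lower A g x" if "\<forall>y. length y = length x \<longrightarrow> f y = g y" for f g x
    using that by (cases x) auto
  ultimately show ?thesis unfolding linear_op_def by blast
qed

lemma linear_op_funpow: "linear_op T \<Longrightarrow> linear_op (T ^^ q)"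
  by (induction q) (simp_all add: linear_op_comp o_def)

lemma raise_spin_weight:
  "raise A (\<lambda>w. \<phi> (spin w) * f w) v = \<phi> (spin v - 2) * raise A f v"
proof (induction v arbitrary: \<phi> f)
  case (Cons b v)
  have "raise A (\<lambda>w. \<phi> (c + spin w) * f (b # w)) v = \<phi> (c + (spin v - 2)) * raise A (\<lambda>w. f (b # w)) v" for c
    using Cons.IH[of "\<lambda>s. \<phi> (c + s)" "\<lambda>w. f (b # w)"] by simp
  from this[of 1] this[of "-1"] show ?case by (cases b) (simp_all add: algebra_simps)
qed simp

lemma raise_twisted_rotation:
  assumes "A \<noteq> 0"
  shows "raise A (twisted_rotation A 0 (-4) f) = twisted_rotation A (-4) 0 (raise A f)"
proof
  fix x
  show "raise A (twisted_rotation A 0 (-4) f) x = twisted_rotation A (-4) 0 (raise A f) x"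
  proof (cases x)
    case (Cons b v)
    define s where "s = spin v"
    have T: "raise A (\<lambda>w. A powi spin w * f (w @ [True])) v = A powi (s - 2) * raise A (\<lambda>w. f (w @ [True])) v"
      using raise_spin_weight[of A "\<lambda>s. A powi s"] by (simp add: s_def)
    have F: "raise A (\<lambda>w. A powi (- spin w - 4) * f (w @ [False])) v =
        A powi (- s - 2) * raise A (\<lambda>w. f (w @ [False])) v"
    proof -
      have "- (s - 2) - 4 = - s - 2" by simp
      thus ?thesis
        using raise_spin_weight[of A "\<lambda>s. A powi (- s - 4)" "\<lambda>w. f (w @ [False])" v]
        by (simp only: s_def[symmetric])
    qed
    have e: "inverse (A\<^sup>2) * A powi (s - 2) = A powi (s - 4)"
         "A\<^sup>2 * A powi (- s - 2) = A powi (- s)"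
         "A powi (s - 4) * A powi (- 2 * s) = A powi (- s - 4)"
      using assms by (simp_all add: power_int_diff power_int_minus field_simps power_int_add[symmetric] flip: power_int_numeral)
    have e': "A powi (s - 4) * (A powi (- 2 * s) * t) = A powi (- s - 4) * t"
       "inverse (A\<^sup>2) * (A powi (s - 2) * t) = A powi (s - 4) * t"
       "A\<^sup>2 * (A powi (- s - 2) * t) = A powi (- s) * t" for t
      using e by (simp_all only: mult.assoc[symmetric])
    show ?thesis
    proof (cases b)
      case True
      have "raise A (twisted_rotation A 0 (-4) f) x =
          A powi (- s - 4) * f (v @ [False]) + A powi (s - 4) * raise A (\<lambda>w. f (w @ [True])) v"
        using T by (simp add: Cons True s_def[symmetric] e')
      also have "\<dots> = twisted_rotation A (-4) 0 (raise A f) x"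
        using assms by (simp add: Cons True s_def[symmetric] raise_snoc distrib_left e' del: mult_minus_left)
      finally show ?thesis .
    next
      case False
      show ?thesis
        using F assms by (simp add: Cons False s_def[symmetric] raise_snoc e')
    qed
  qed simp
qed

context
  fixes A :: "'a::field" and p :: nat
  assumes A: "A \<noteq> 0" and p: "p \<ge> 1"
begin

lemma coxeter_decomposition:
  assumes "length x = p"
  shows "braid_op A (coxeter p) f x = twisted_rotation A 0 (-4) f x + lower A (raise A f) x"
proof -
  obtain n where n: "p = Suc n" using p by (cases p) auto
  have "length x = Suc n" using assms n by simp
  thus ?thesis
    unfolding n braid_op_coxeter[OF A \<open>length x = Suc n\<close>]
    by (cases x) auto
qed

lemma raise_lower:
  assumes "length x = p"
  shows "raise A (lower A h) x = braid_op A (coxeter p) h x - twisted_rotation A (-4) 0 h x"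
proof -
  obtain b v where x: "x = b # v" using assms p by (cases x) auto
  define s where "s = spin v"
  define k where "k = A - A powi (-3)"
  have W: "raise A (\<lambda>w. k * A powi (spin w - 1) * h (w @ [True])) v =
      k * A powi (s - 3) * raise A (\<lambda>w. h (w @ [True])) v"
    using raise_spin_weight[of A "\<lambda>s. k * A powi (s - 1)"] by (simp add: s_def)
  have e: "k * A powi (s - 1) = A powi s - A powi (s - 4)"
    using A by (simp add: k_def left_diff_distrib power_int_diff power_int_minus field_simps power_numeral_reduce)
  have e': "k * (A powi (s - 1) * t) = A powi s * t - A powi (s - 4) * t" for t
    by (simp only: mult.assoc[symmetric] e left_diff_distrib)
  have e2: "A\<^sup>2 * A powi (s - 3) = A powi (s - 1)"
    using A by (simp add: power_int_diff field_simps power_numeral_reduce)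
  have "k * A powi (s - 1) * A powi (- 2 * s) = A powi s * A powi (- 2 * s) - A powi (s - 4) * A powi (- 2 * s)"
    by (simp only: e left_diff_distrib)
  also have "\<dots> = A powi (- s) - A powi (- s - 4)"
    using A by (simp add: power_int_add[symmetric])
  finally have e3: "k * A powi (s - 1) * A powi (- 2 * s) = A powi (- s) - A powi (- s - 4)" .
  show ?thesis
  proof (cases b)
    case True
    thus ?thesis
      using coxeter_decomposition[OF assms, of h]
      by (simp add: x s_def[symmetric] k_def[symmetric] linear_op_zero[OF linear_op_raise] e' mult.assoc)
  next
    case False
    have "raise A (lower A h) x = k * A powi (s - 1) * raise A (\<lambda>w. h (w @ [True])) v"
      using False W by (simp add: x s_def[symmetric] k_def[symmetric] e2[symmetric] mult_ac)
    also have "\<dots> = k * A powi (s - 1) * (raise A h (v @ [True]) - A powi (- 2 * s) * h (v @ [False]))"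
      using A by (simp add: raise_snoc s_def)
    also have "\<dots> = k * A powi (s - 1) * raise A h (v @ [True]) - (A powi (- s) - A powi (- s - 4)) * h (v @ [False])"
      by (simp only: right_diff_distrib mult.assoc[symmetric] e3)
    finally show ?thesis
      using coxeter_decomposition[OF assms, of h] False
      by (simp add: x s_def[symmetric] k_def[symmetric] algebra_simps)
  qed
qed

text \<open>
  Write \<open>C\<close>, \<open>U\<close>, \<open>U'\<close> for the braid and the two rotations, \<open>R\<close> and \<open>L\<close> for raising and
  lowering.  If \<open>Z\<close> works for \<open>q\<close>, then \<open>C Z + L U'\<^sup>q\<close> works for \<open>q + 1\<close>, because \<open>R\<close> commutes
  with \<open>C\<close> and turns \<open>U\<close> into \<open>U'\<close>.
\<close>

lemma coxeter_power_decomposition: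
  "\<exists>Z. linear_op Z \<and> (\<forall>f x. length x = p \<longrightarrow>
     (braid_op A (coxeter p) ^^ q) f x = (twisted_rotation A 0 (-4) ^^ q) f x + Z (raise A f) x \<and>
     raise A (Z f) x = (braid_op A (coxeter p) ^^ q) f x - (twisted_rotation A (-4) 0 ^^ q) f x)"
proof (induction q)
  case 0
  show ?case
    by (intro exI[of _ "\<lambda>f x. 0"]) (simp add: linear_op_null linear_op_zero[OF linear_op_raise])
next
  case (Suc q)
  let ?C = "braid_op A (coxeter p)" and ?U = "twisted_rotation A 0 (-4)" and ?U' = "twisted_rotation A (-4) 0"
  obtain Z where Z: "linear_op Z"
    and 1: "\<And>f x. length x = p \<Longrightarrow> (?C ^^ q) f x = (?U ^^ q) f x + Z (raise A f) x"
    and 2: "\<And>f x. length x = p \<Longrightarrow> raise A (Z f) x = (?C ^^ q) f x - (?U' ^^ q) f x"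
    using Suc.IH by blast
  note lin = linear_op_braid_op[of A "coxeter p"]
  have rU: "raise A ((?U ^^ q) f) = (?U' ^^ q) (raise A f)" for f
    by (induction q) (simp_all add: raise_twisted_rotation[OF A])
  define Z' where "Z' = (\<lambda>h x. 1 * ?C (Z h) x + 1 * lower A ((?U' ^^ q) h) x)"
  have "linear_op Z'"
    unfolding Z'_def
    by (rule linear_op_lincomb[OF linear_op_comp[OF lin Z]
          linear_op_comp[OF linear_op_lower linear_op_funpow[OF linear_op_twisted_rotation]]])
  moreover have "(?C ^^ Suc q) f x = (?U ^^ Suc q) f x + Z' (raise A f) x" if "length x = p" for f x
  proof -
    have "(?C ^^ Suc q) f x = ?C (\<lambda>y. (?U ^^ q) f y + Z (raise A f) y) x"
      unfolding funpow.simps o_apply by (rule linear_op_cong[OF lin]) (use 1 that in simp)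
    also have "\<dots> = ?C ((?U ^^ q) f) x + ?C (Z (raise A f)) x"
      by (rule linear_op_add[OF lin])
    also have "?C ((?U ^^ q) f) x = ?U ((?U ^^ q) f) x + lower A ((?U' ^^ q) (raise A f)) x"
      by (simp add: coxeter_decomposition[OF that] rU)
    finally show ?thesis by (simp add: Z'_def)
  qed
  moreover have "raise A (Z' f) x = (?C ^^ Suc q) f x - (?U' ^^ Suc q) f x" if "length x = p" for f x
  proof -
    have "raise A (Z' f) x = raise A (?C (Z f)) x + raise A (lower A ((?U' ^^ q) f)) x"
      by (simp add: Z'_def linear_op_add[OF linear_op_raise])
    also have "raise A (?C (Z f)) x = ?C (raise A (Z f)) x"
      by (simp add: raise_braid_op[OF A])
    also have "\<dots> = ?C (\<lambda>y. (?C ^^ q) f y + (-1) * (?U' ^^ q) f y) x"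
      by (rule linear_op_cong[OF lin]) (use 2 that in simp)
    also have "\<dots> = ?C ((?C ^^ q) f) x + (-1) * ?C ((?U' ^^ q) f) x"
      unfolding linear_op_add[OF lin] linear_op_scale[OF lin] by simp
    finally show ?thesis by (simp add: raise_lower[OF that])
  qed
  ultimately show ?case by blast
qed

text \<open>
  The difference of the traces for \<open>C\<close> and \<open>U\<close> is the trace of \<open>Z X R\<close>, the difference for
  \<open>C\<close> and \<open>U'\<close> that of \<open>R Z X\<close>, and these agree up to the factor \<open>z\<^sup>2\<close>.
\<close>

theorem qtrace_coxeter_power:
  assumes "z \<noteq> 0" "linear_op X" "\<And>f. raise A (X f) = X (raise A f)"
  shows "(z\<^sup>2 - 1) * qtrace z p (\<lambda>f. (braid_op A (coxeter p) ^^ q) (X f)) =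
     z\<^sup>2 * qtrace z p (\<lambda>f. (twisted_rotation A 0 (-4) ^^ q) (X f))
     - qtrace z p (\<lambda>f. (twisted_rotation A (-4) 0 ^^ q) (X f))"
proof -
  let ?C = "braid_op A (coxeter p)" and ?U = "twisted_rotation A 0 (-4)" and ?U' = "twisted_rotation A (-4) 0"
  obtain Z where Z: "linear_op Z"
    and 1: "\<And>f x. length x = p \<Longrightarrow> (?C ^^ q) f x = (?U ^^ q) f x + Z (raise A f) x"
    and 2: "\<And>f x. length x = p \<Longrightarrow> raise A (Z f) x = (?C ^^ q) f x - (?U' ^^ q) f x"
    using coxeter_power_decomposition by blast
  let ?t = "qtrace z p (\<lambda>f. (?C ^^ q) (X f))" and ?u = "qtrace z p (\<lambda>f. (?U ^^ q) (X f))"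
  let ?u' = "qtrace z p (\<lambda>f. (?U' ^^ q) (X f))"
  have "?t = qtrace z p (\<lambda>f x. 1 * (?U ^^ q) (X f) x + 1 * Z (X (raise A f)) x)"
    by (rule qtrace_same, unfold same_on_def) (use 1 assms(3) in simp)
  hence t: "?t = ?u + qtrace z p (\<lambda>f. Z (X (raise A f)))"
    by (simp only: qtrace_lincomb) simp
  have "qtrace z p (\<lambda>f. raise A (Z (X f))) = z powi 2 * qtrace z p (\<lambda>f. Z (X (raise A f)))"
    by (rule qtrace_commute[OF assms(1) linear_op_raise linear_op_comp[OF Z assms(2)] shifts_spin_raise])
  moreover have "qtrace z p (\<lambda>f. raise A (Z (X f))) = qtrace z p (\<lambda>f x. 1 * (?C ^^ q) (X f) x + (-1) * (?U' ^^ q) (X f) x)"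
    by (rule qtrace_same, unfold same_on_def) (use 2 in simp)
  ultimately have "?t - ?u' = z\<^sup>2 * (?t - ?u)"
    by (simp only: qtrace_lincomb t) simp
  thus ?thesis by (simp add: algebra_simps)
qed

end

lemma braid_op_concat_replicate: "braid_op A (concat (replicate q w)) = braid_op A w ^^ q"
  by (induction q) (auto simp: braid_op_append o_def)

text \<open>
  The number of up spins among the \<open>q\<close> spins that are carried from the front to the end, one
  after another, when the list is rotated \<open>q\<close> times.
\<close>

definition up_count :: "nat \<Rightarrow> bool list \<Rightarrow> int" where
  "up_count q x = (\<Sum>r<q. of_bool (x ! (r mod length x)))"

lemma up_count_rotate1:
  assumes "x \<noteq> []"
  shows "up_count (Suc q) x = of_bool (hd x) + up_count q (rotate1 x)"
proof -
  have "rotate1 x ! (r mod length x) = x ! (Suc r mod length x)" for r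
    using assms by (simp add: nth_rotate1 mod_Suc_eq)
  thus ?thesis
    using assms by (simp add: up_count_def sum.lessThan_Suc_shift hd_conv_nth del: sum.lessThan_Suc)
qed

lemma spin_rotate1 [simp]: "spin (rotate1 x) = spin x"
  by (cases x) auto

text \<open>
  Rotation preserves the total spin, so the weight of one rotation depends only on the spin
  that is moved.
\<close>

lemma twisted_rotation_funpow:
  assumes "A \<noteq> 0" "x \<noteq> []"
  shows "(twisted_rotation A \<alpha> \<beta> ^^ q) f x =
    A powi ((spin x - 1 + \<alpha>) * up_count q x + (- spin x - 1 + \<beta>) * (int q - up_count q x)) * f (rotate q x)"
  using assms(2)
proof (induction q arbitrary: x)
  case 0
  thus ?case by (simp add: up_count_def)
next
  case (Suc q)
  let ?c = "if hd x then spin x - 1 + \<alpha> else - spin x - 1 + \<beta>" and ?n = "up_count q (rotate1 x)"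
  have "(twisted_rotation A \<alpha> \<beta> ^^ Suc q) f x = A powi ?c * (twisted_rotation A \<alpha> \<beta> ^^ q) f (rotate1 x)"
    using Suc.prems by (cases x) (auto simp: algebra_simps)
  also have "\<dots> = A powi ?c * A powi ((spin x - 1 + \<alpha>) * ?n + (- spin x - 1 + \<beta>) * (int q - ?n)) * f (rotate q (rotate1 x))"
    using Suc.IH[of "rotate1 x"] Suc.prems by simp
  also have "rotate q (rotate1 x) = rotate (Suc q) x"
    by (simp add: rotate_def funpow_swap1)
  also have "A powi ?c * A powi ((spin x - 1 + \<alpha>) * ?n + (- spin x - 1 + \<beta>) * (int q - ?n)) =
     A powi ((spin x - 1 + \<alpha>) * up_count (Suc q) x + (- spin x - 1 + \<beta>) * (int (Suc q) - up_count (Suc q) x))"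
    using assms(1) up_count_rotate1[OF Suc.prems, of q]
    by (auto simp: power_int_add[symmetric] algebra_simps)
  finally show ?case .
qed

section \<open>Traces of powers of a twisted rotation\<close>

lemma mult_mod_eq_iff:
  fixes p q :: nat
  assumes "coprime p q"
  shows "i * q mod p = j * q mod p \<longleftrightarrow> i mod p = j mod p"
  using cong_mult_rcancel_nat[of q p i j] assms by (simp add: cong_def coprime_commute)

lemma bij_betw_mult_mod:
  fixes p q :: nat
  assumes "coprime p q" "p \<ge> 1"
  shows "bij_betw (\<lambda>m. m * q mod p) {1..p} {..<p}"
proof -
  have "inj_on (\<lambda>m. m * q mod p) {1..p}"
  proof (rule inj_onI)
    fix i j assume "i \<in> {1..p}" "j \<in> {1..p}" "i * q mod p = j * q mod p"
    hence "i mod p = j mod p" "1 \<le> i" "i \<le> p" "1 \<le> j" "j \<le> p"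
      using mult_mod_eq_iff[OF assms(1)] by auto
    thus "i = j" by (cases "i = p"; cases "j = p") auto
  qed
  moreover from card_image[OF this] have "(\<lambda>m. m * q mod p) ` {1..p} = {..<p}"
    using assms(2) by (intro card_subset_eq) auto
  ultimately show ?thesis by (simp add: bij_betw_def)
qed

lemma mult_mod_surj:
  fixes p q :: nat
  assumes "coprime p q" "i < p"
  obtains m where "m \<in> {1..p}" "i = m * q mod p"
proof -
  have "i \<in> (\<lambda>m. m * q mod p) ` {1..p}"
    using bij_betw_mult_mod[OF assms(1)] assms(2) by (simp add: bij_betw_def)
  thus ?thesis using that by blast
qed

lemma Suc_mult_mod: "(m * q mod p + q) mod p = Suc m * q mod p" for p q :: nat
  by (simp add: mod_simps add.commute)

lemma spin_eq_sum: "spin x = (\<Sum>i<length x. if x ! i then 1 else -1)"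
proof (induction x)
  case (Cons b x)
  thus ?case by (simp add: sum.lessThan_Suc_shift del: sum.lessThan_Suc)
qed simp

lemma rotate_eq_self_iff:
  assumes "coprime p q" "p \<ge> 1" "length x = p"
  shows "rotate q x = x \<longleftrightarrow> x = replicate p True \<or> x = replicate p False"
proof
  assume rot: "rotate q x = x"
  have step: "x ! ((i + q) mod p) = x ! i" if "i < p" for i
    using nth_rotate[of i x q] that assms(3) rot by (simp add: add.commute)
  have "x ! (m * q mod p) = x ! 0" for m
  proof (induction m)
    case (Suc m)
    show ?case using step[of "m * q mod p"] Suc assms(2) unfolding Suc_mult_mod by simp
  qed simp
  hence const: "x ! i = x ! 0" if "i < p" for i
    using mult_mod_surj[OF assms(1) that] by metis
  have "x = replicate p (x ! 0)"
  proof (rule nth_equalityI)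
    fix i assume "i < length x"
    thus "x ! i = replicate p (x ! 0) ! i" using const[of i] assms(3) by (simp only: nth_replicate)
  qed (simp add: assms(3))
  thus "x = replicate p True \<or> x = replicate p False" by (metis (full_types))
next
  assume "x = replicate p True \<or> x = replicate p False"
  thus "rotate q x = x" by (auto intro!: nth_equalityI simp: nth_rotate)
qed

lemma spin_replicate: "spin (replicate n b) = (if b then int n else - int n)"
  by (induction n) auto

lemma up_count_replicate: "n \<ge> 1 \<Longrightarrow> up_count q (replicate n b) = (if b then int q else 0)"
  by (auto simp: up_count_def)

text \<open>
  The sum of the weights with which a state of total spin \<open>S\<close> and its opposite enter the trace of a power
  of a twisted rotation that moves \<open>n\<close> up spins and \<open>n'\<close> down spins of the former.
\<close>

definition rotation_terms :: "'a::field \<Rightarrow> 'a \<Rightarrow> int \<Rightarrow> int \<Rightarrow> int \<Rightarrow> int \<Rightarrow> int \<Rightarrow> 'a" where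
  "rotation_terms z A S n n' \<alpha> \<beta> =
     z powi S * A powi ((S - 1 + \<alpha>) * n + (- S - 1 + \<beta>) * n') +
     z powi (- S) * A powi ((- S - 1 + \<alpha>) * n' + (S - 1 + \<beta>) * n)"

lemma qtrace_twisted_rotation:
  assumes "(A::'a::field) \<noteq> 0" "coprime p q" "p \<ge> 1"
  shows "qtrace z p (twisted_rotation A \<alpha> \<beta> ^^ q) =
     rotation_terms z A (- int p) 0 (int q) \<alpha> \<beta>"
proof -
  let ?w = "\<lambda>x. z powi spin x *
    A powi ((spin x - 1 + \<alpha>) * up_count q x + (- spin x - 1 + \<beta>) * (int q - up_count q x))"
  have "qtrace z p (twisted_rotation A \<alpha> \<beta> ^^ q) = (\<Sum>x\<in>states p. if rotate q x = x then ?w x else 0)"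
    unfolding qtrace_def
  proof (intro sum.cong refl)
    fix x assume "x \<in> states p"
    hence "x \<noteq> []" using assms(3) by (auto simp: states_def)
    thus "z powi spin x * (twisted_rotation A \<alpha> \<beta> ^^ q) (basis x) x = (if rotate q x = x then ?w x else 0)"
      by (simp add: twisted_rotation_funpow[OF assms(1)] basis_def)
  qed
  also have "\<dots> = (\<Sum>x\<in>{x \<in> states p. rotate q x = x}. ?w x)"
    by (simp add: sum.inter_filter)
  also have "{x \<in> states p. rotate q x = x} = {replicate p True, replicate p False}"
    using rotate_eq_self_iff[OF assms(2,3)] by (auto simp: states_def)
  also have "(\<Sum>x\<in>\<dots>. ?w x) = ?w (replicate p True) + ?w (replicate p False)"
  proof -
    have "replicate p True \<noteq> replicate p False" using assms(3) by (metis nth_replicate less_le_trans zero_less_one)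
    thus ?thesis by simp
  qed
  finally show ?thesis using assms(3) by (simp add: spin_replicate up_count_replicate rotation_terms_def)
qed

text \<open>
  The set consists of the multiples \<open>q, 2q, \<dots>, kq\<close> modulo \<open>p\<close>.  If \<open>kq\<close> is 1 modulo \<open>p\<close>, it
  is one of the two cycles of the permutation of positions that adds \<open>q\<close> and then exchanges
  the images of 0 and 1.
\<close>

definition two_cycle_state :: "nat \<Rightarrow> nat \<Rightarrow> nat \<Rightarrow> bool \<Rightarrow> bool list" where
  "two_cycle_state p q k b = map (\<lambda>i. (i \<in> (\<lambda>m. m * q mod p) ` {1..k}) = b) [0..<p]"

definition swap2 :: "bool list \<Rightarrow> bool list" where
  "swap2 y = y[0 := y ! 1, 1 := y ! 0]"

lemma length_two_cycle_state [simp]: "length (two_cycle_state p q k b) = p"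
  by (simp add: two_cycle_state_def)

context
  fixes p q k l :: nat
  assumes cop: "coprime p q" and k: "0 < k" "k < p" and kl: "q * k = p * l + 1"
begin

lemma p2: "p \<ge> 2" using k by simp

lemma two_cycle_state_nth:
  assumes "1 \<le> m" "m \<le> p"
  shows "two_cycle_state p q k b ! (m * q mod p) = ((m \<le> k) = b)"
proof -
  have "inj_on (\<lambda>m. m * q mod p) {1..p}"
    using bij_betw_mult_mod[OF cop] p2 by (auto simp: bij_betw_def)
  hence "m * q mod p \<in> (\<lambda>m. m * q mod p) ` {1..k} \<longleftrightarrow> m \<in> {1..k}"
    using assms k by (intro inj_on_image_mem_iff[of _ "{1..p}"]) auto
  thus ?thesis using assms p2 by (simp add: two_cycle_state_def)
qed

lemma kq_mod: "k * q mod p = 1"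
proof -
  have "k * q = 1 + p * l" using kl by (simp add: mult.commute)
  hence "k * q mod p = 1 mod p" by (simp only: mod_mult_self2)
  thus ?thesis using p2 by simp
qed

text \<open>
  Write the position \<open>i\<close> as \<open>mq\<close> modulo \<open>p\<close> with \<open>1 \<le> m \<le> p\<close>.  Adding \<open>q\<close> is \<open>m \<mapsto> m + 1\<close>,
  the position 0 is \<open>m = p\<close> and the position 1 is \<open>m = k\<close>.  The exchange cuts the cycle of
  length \<open>p\<close> after \<open>k\<close> and closes up the two pieces.
\<close>

lemma rotate_two_cycle_iff:
  assumes "length x = p"
  shows "swap2 (rotate q x) = x \<and> x ! 0 \<noteq> x ! 1 \<longleftrightarrow>
     x = two_cycle_state p q k True \<or> x = two_cycle_state p q k False"
proof -
  let ?X = "\<lambda>m. x ! (m * q mod p)"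
  have rot: "rotate q x ! i = x ! ((i + q) mod p)" if "i < p" for i
    using nth_rotate[of i x q] that assms by (simp add: add.commute)
  have "swap2 (rotate q x) = x \<longleftrightarrow> (\<forall>i<p. x ! i = swap2 (rotate q x) ! i)"
    using assms by (auto simp: list_eq_iff_nth_eq swap2_def)
  also have "\<dots> \<longleftrightarrow> (\<forall>m\<in>{1..p}. ?X m = swap2 (rotate q x) ! (m * q mod p))"
  proof -
    have "{..<p} = (\<lambda>m. m * q mod p) ` {1..p}"
      using bij_betw_mult_mod[OF cop] p2 by (simp add: bij_betw_def)
    hence "(\<forall>i\<in>{..<p}. Q i) \<longleftrightarrow> (\<forall>m\<in>{1..p}. Q (m * q mod p))" for Q by simp
    thus ?thesis by (simp add: lessThan_def)
  qed
  also have "\<dots> \<longleftrightarrow> (\<forall>m\<in>{1..p}. ?X m = ?X (if m = p then Suc k else if m = k then 1 else Suc m))"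
  proof (intro ball_cong refl)
    fix m assume m: "m \<in> {1..p}"
    have z: "m * q mod p = 0 \<longleftrightarrow> m = p"
      using mult_mod_eq_iff[OF cop, of m p] m by (auto simp: le_less)
    have o: "m * q mod p = 1 \<longleftrightarrow> m = k"
      using mult_mod_eq_iff[OF cop, of m k] m k kq_mod by (auto simp: le_less)
    have lt: "m * q mod p < p" using p2 by simp
    have "swap2 (rotate q x) ! (m * q mod p) =
       (if m = p then rotate q x ! 1 else if m = k then rotate q x ! 0 else rotate q x ! (m * q mod p))"
      using z o lt assms p2 by (auto simp: swap2_def nth_list_update)
    also have "rotate q x ! 1 = ?X (Suc k)"
    proof -
      have "(1 + q) mod p = Suc k * q mod p" using Suc_mult_mod[of k q p] unfolding kq_mod .
      thus ?thesis using rot[of 1] p2 by simp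
    qed
    also have "rotate q x ! 0 = ?X 1" using rot[of 0] p2 by simp
    also have "rotate q x ! (m * q mod p) = ?X (Suc m)" using rot[OF lt] unfolding Suc_mult_mod .
    finally show "(?X m = swap2 (rotate q x) ! (m * q mod p)) =
        (?X m = ?X (if m = p then Suc k else if m = k then 1 else Suc m))" by auto
  qed
  finally have eq: "swap2 (rotate q x) = x \<longleftrightarrow>
      (\<forall>m\<in>{1..p}. ?X m = ?X (if m = p then Suc k else if m = k then 1 else Suc m))" .
  have x01: "x ! 0 = ?X p" "x ! 1 = ?X k" using kq_mod by simp_all
  show ?thesis
  proof
    assume L: "swap2 (rotate q x) = x \<and> x ! 0 \<noteq> x ! 1"
    have st: "?X m = ?X (if m = p then Suc k else if m = k then 1 else Suc m)" if "m \<in> {1..p}" for m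
      using L eq that by blast
    have lo: "?X m = ?X k" if "1 \<le> m" "m \<le> k" for m
      using that(2,1)
    proof (induction rule: inc_induct)
      case (step n)
      thus ?case using st[of n] k by auto
    qed simp
    have hi: "?X m = ?X p" if "Suc k \<le> m" "m \<le> p" for m
      using that(2,1)
    proof (induction rule: inc_induct)
      case (step n)
      thus ?case using st[of n] k by auto
    qed simp
    have "x = two_cycle_state p q k (x ! 1)"
    proof (rule nth_equalityI)
      fix i assume "i < length x"
      then obtain m where m: "m \<in> {1..p}" "i = m * q mod p"
        using mult_mod_surj[OF cop] assms by metis
      show "x ! i = two_cycle_state p q k (x ! 1) ! i"
      proof (cases "m \<le> k")
        case True
        hence "x ! i = x ! 1" using lo[of m] m(1) unfolding m(2) x01 by simp
        moreover have "two_cycle_state p q k (x ! 1) ! i = x ! 1"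
          using two_cycle_state_nth[of m "x ! 1"] m(1) True unfolding m(2) by simp
        ultimately show ?thesis by simp
      next
        case False
        hence "x ! i = x ! 0" using hi[of m] m(1) unfolding m(2) x01 by simp
        moreover have "two_cycle_state p q k (x ! 1) ! i = (\<not> x ! 1)"
          using two_cycle_state_nth[of m "x ! 1"] m(1) False unfolding m(2) by simp
        ultimately show ?thesis using L by simp
      qed
    qed (simp add: assms)
    thus "x = two_cycle_state p q k True \<or> x = two_cycle_state p q k False" by (metis (full_types))
  next
    assume "x = two_cycle_state p q k True \<or> x = two_cycle_state p q k False"
    then obtain b where x: "x = two_cycle_state p q k b" by blast
    define Y where "Y = ?X"
    have "Y m = ((m \<le> k) = b)" if "1 \<le> m" "m \<le> p" for m
      using two_cycle_state_nth that by (simp add: x Y_def)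
    hence "(\<forall>m\<in>{1..p}. Y m = Y (if m = p then Suc k else if m = k then 1 else Suc m)) \<and> Y p \<noteq> Y k"
      using k by auto
    thus "swap2 (rotate q x) = x \<and> x ! 0 \<noteq> x ! 1"
      unfolding eq x01 Y_def .
  qed
qed

lemma sum_two_cycle_state:
  "(\<Sum>i<p. h (two_cycle_state p q k b ! i)) = of_nat k * h b + of_nat (p - k) * (h (\<not> b) :: int)"
proof -
  have "(\<Sum>i<p. h (two_cycle_state p q k b ! i)) = (\<Sum>m\<in>{1..p}. h (two_cycle_state p q k b ! (m * q mod p)))"
    using sum.reindex_bij_betw[OF bij_betw_mult_mod[OF cop], symmetric] p2 by simp
  also have "\<dots> = (\<Sum>m\<in>{1..p}. h ((m \<le> k) = b))"
    by (intro sum.cong refl) (simp add: two_cycle_state_nth)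
  also have "{1..p} = {1..k} \<union> {Suc k..p}" using k by auto
  also have "(\<Sum>m\<in>\<dots>. h ((m \<le> k) = b)) = (\<Sum>m\<in>{1..k}. h b) + (\<Sum>m\<in>{Suc k..p}. h (\<not> b))"
    by (subst sum.union_disjoint) (auto intro!: arg_cong2[of _ _ _ _ "(+)"] sum.cong arg_cong[of _ _ h])
  finally show ?thesis by simp
qed

lemma spin_two_cycle_state:
  "spin (two_cycle_state p q k b) = (if b then 2 * int k - int p else int p - 2 * int k)"
  using sum_two_cycle_state[of "\<lambda>b. if b then 1 else -1" b] k
  by (simp add: spin_eq_sum of_nat_diff split: if_splits)

text \<open>
  Double counting.  Let \<open>N i\<close> be the number of up spins in the window of length \<open>q\<close> that
  starts at \<open>i\<close>.  As the state is fixed by the rotation up to the exchange of two spins, \<open>N\<close> is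
  constant except at \<open>i = 1\<close>, while the sum of all \<open>N i\<close> is \<open>q\<close> times the number of up spins.
\<close>

lemma up_count_two_cycle_state:
  "up_count q (two_cycle_state p q k b) = (if b then int l else int q - int l)"
proof -
  let ?x = "two_cycle_state p q k b"
  define \<chi> where "\<chi> = (\<lambda>i. of_bool (?x ! (i mod p)) :: int)"
  define N where "N = (\<lambda>i. \<Sum>r<q. \<chi> (i + r))"
  have len: "length ?x = p" by simp
  have fixed: "swap2 (rotate q ?x) = ?x"
    using rotate_two_cycle_iff[OF len] by (cases b) auto
  have x01: "?x ! 1 = b" "?x ! 0 = (\<not> b)"
    using two_cycle_state_nth[of k b] two_cycle_state_nth[of p b] kq_mod k by simp_all
  have rot: "rotate q ?x ! i = ?x ! ((i + q) mod p)" if "i < p" for i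
    using nth_rotate[of i ?x q] that len by (simp add: add.commute)
  have shift: "\<chi> (i + q) = (if i = 0 then \<chi> 1 else if i = 1 then \<chi> 0 else \<chi> i)" if "i < p" for i
  proof -
    have s: "swap2 (rotate q ?x) ! j = (if j = 0 then rotate q ?x ! 1 else if j = 1 then rotate q ?x ! 0
        else rotate q ?x ! j)" if "j < p" for j
      using that p2 by (simp add: swap2_def nth_list_update)
    have "\<chi> (i + q) = of_bool (rotate q ?x ! i)" using rot[OF that] by (simp add: \<chi>_def)
    also have "rotate q ?x ! i = ?x ! (if i = 0 then 1 else if i = 1 then 0 else i)"
      using s[of "if i = 0 then 1 else if i = 1 then 0 else i"] that p2 unfolding fixed by (simp split: if_splits)
    finally show ?thesis using that p2 by (simp add: \<chi>_def)
  qed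
  have NSuc: "N (Suc i) = N i + \<chi> (i + q) - \<chi> i" for i
  proof -
    have "\<chi> i + N (Suc i) = (\<Sum>r<Suc q. \<chi> (i + r))"
      by (simp add: N_def sum.lessThan_Suc_shift del: sum.lessThan_Suc)
    thus ?thesis by (simp add: N_def)
  qed
  \<comment> \<open>the jump of \<open>N\<close> between the windows starting at 0 and at 1\<close>
  define d where "d = (if b then 1 else -1 :: int)"
  have chi: "\<chi> 1 - \<chi> 0 = d" using x01 p2 by (auto simp: \<chi>_def d_def)
  have N1: "N 1 = N 0 + d" using NSuc[of 0] shift[of 0] chi p2 by simp
  have N2: "N (Suc (Suc i)) = N 0" if "Suc i < p" for i
    using that
  proof (induction i)
    case 0
    thus ?case using NSuc[of 1] shift[of 1] chi N1 by simp
  next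
    case (Suc i)
    thus ?case using NSuc[of "Suc (Suc i)"] shift[of "Suc (Suc i)"] by simp
  qed
  have "(\<Sum>i<p. N i) = int p * N 0 + d"
  proof -
    obtain r where r: "p = Suc (Suc r)" using p2 by (metis add_2_eq_Suc le_Suc_ex)
    have "(\<Sum>i<p. N i) = N 0 + (N 1 + (\<Sum>i<r. N (Suc (Suc i))))"
      unfolding r by (simp add: sum.lessThan_Suc_shift del: sum.lessThan_Suc)
    also have "(\<Sum>i<r. N (Suc (Suc i))) = int r * N 0" using N2 r by simp
    finally show ?thesis unfolding N1 by (simp add: r algebra_simps del: sum.lessThan_Suc)
  qed
  moreover have "(\<Sum>i<p. N i) = int q * (\<Sum>i<p. \<chi> i)"
  proof -
    have per: "(\<Sum>i<p. \<chi> (i + r)) = (\<Sum>i<p. \<chi> i)" for r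
    proof (induction r)
      case (Suc r)
      have "\<chi> r + (\<Sum>i<p. \<chi> (i + Suc r)) = (\<Sum>i<Suc p. \<chi> (i + r))"
        by (simp add: sum.lessThan_Suc_shift del: sum.lessThan_Suc)
      also have "\<dots> = (\<Sum>i<p. \<chi> (i + r)) + \<chi> r" by (simp add: \<chi>_def)
      finally show ?case using Suc by simp
    qed simp
    have "(\<Sum>i<p. N i) = (\<Sum>r<q. \<Sum>i<p. \<chi> (i + r))"
      unfolding N_def by (rule sum.swap)
    thus ?thesis by (simp add: per)
  qed
  moreover have "(\<Sum>i<p. \<chi> i) = (if b then int k else int p - int k)"
    using sum_two_cycle_state[of "of_bool :: bool \<Rightarrow> int" b] k by (simp add: \<chi>_def of_nat_diff)
  moreover have "up_count q ?x = N 0" by (simp add: up_count_def N_def \<chi>_def len)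
  ultimately have "int p * up_count q ?x + d = int q * (if b then int k else int p - int k)" by simp
  moreover have "int q * int k = int p * int l + 1" using kl by (metis of_nat_1 of_nat_add of_nat_mult)
  ultimately have "int p * up_count q ?x = int p * (if b then int l else int q - int l)"
    by (cases b) (simp_all only: d_def if_True if_False right_diff_distrib simp_thms
        mult.commute[of "int q" "int p"])
  thus ?thesis using p2 by simp
qed

lemma two_cycle_state_neq: "two_cycle_state p q k True \<noteq> two_cycle_state p q k False"
  using two_cycle_state_nth[of k True] two_cycle_state_nth[of k False] k by auto

text \<open>
  The diagonal entries of the cup-cap pair do not contribute, because a state with two different
  spins is not fixed by the rotation; its two off-diagonal entries are 1.
\<close>

lemma cup_cap_basis_rotate:
  assumes "(a::'a::field) \<noteq> 0" "length x = p"
  shows "cup_cap a (basis x) (rotate q x) = of_bool (swap2 (rotate q x) = x \<and> x ! 0 \<noteq> x ! 1)"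
proof -
  obtain b c v where y: "rotate q x = b # c # v"
    using assms(2) p2 by (metis Suc_le_length_iff length_rotate numeral_2_eq_2)
  have "rotate q x \<noteq> x" if "b \<noteq> c"
  proof
    assume "rotate q x = x"
    hence "x = replicate p True \<or> x = replicate p False"
      using rotate_eq_self_iff[OF cop] assms(2) p2 by simp
    hence "x ! 0 = x ! 1" using p2 by auto
    thus False using that y \<open>rotate q x = x\<close> by simp
  qed
  hence "b \<noteq> c \<Longrightarrow> x \<noteq> b # c # v" using y by auto
  thus ?thesis using assms(1)
    by (cases b; cases c) (auto simp: y swap2_def basis_def)
qed

lemma qtrace_twisted_rotation_cup_cap:
  assumes "(A::'a::field) \<noteq> 0" "a \<noteq> 0"
  shows "qtrace z p (\<lambda>f. (twisted_rotation A \<alpha> \<beta> ^^ q) (cup_cap a f)) =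
     rotation_terms z A (2 * int k - int p) (int l) (int q - int l) \<alpha> \<beta>"
proof -
  let ?w = "\<lambda>x. z powi spin x *
    A powi ((spin x - 1 + \<alpha>) * up_count q x + (- spin x - 1 + \<beta>) * (int q - up_count q x))"
  let ?P = "\<lambda>x. swap2 (rotate q x) = x \<and> x ! 0 \<noteq> x ! 1"
  have "qtrace z p (\<lambda>f. (twisted_rotation A \<alpha> \<beta> ^^ q) (cup_cap a f)) = (\<Sum>x\<in>states p. if ?P x then ?w x else 0)"
    unfolding qtrace_def
  proof (intro sum.cong refl)
    fix x assume "x \<in> states p"
    hence x: "x \<noteq> []" "length x = p" using p2 by (auto simp: states_def)
    show "z powi spin x * (twisted_rotation A \<alpha> \<beta> ^^ q) (cup_cap a (basis x)) x = (if ?P x then ?w x else 0)"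
      unfolding twisted_rotation_funpow[OF assms(1) x(1)] cup_cap_basis_rotate[OF assms(2) x(2)] by simp
  qed
  also have "\<dots> = (\<Sum>x\<in>{x \<in> states p. ?P x}. ?w x)"
    by (simp add: sum.inter_filter)
  also have "{x \<in> states p. ?P x} = {two_cycle_state p q k True, two_cycle_state p q k False}"
  proof (intro set_eqI)
    fix x show "x \<in> {x \<in> states p. ?P x} \<longleftrightarrow> x \<in> {two_cycle_state p q k True, two_cycle_state p q k False}"
      using rotate_two_cycle_iff[of x] by (cases "length x = p") (simp add: states_def, auto simp: states_def)
  qed
  also have "(\<Sum>x\<in>\<dots>. ?w x) = ?w (two_cycle_state p q k True) + ?w (two_cycle_state p q k False)"
    using two_cycle_state_neq by simp
  finally show ?thesis
    by (simp add: spin_two_cycle_state up_count_two_cycle_state rotation_terms_def)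
qed

end

section \<open>The Jones polynomial of the twisted torus knots\<close>

text \<open>
  On the image of \<open>e\<^sub>1\<close> the inverse crossing \<open>A\<^sup>-\<^sup>1 + A e\<^sub>1\<close> is multiplication by \<open>- A\<^sup>3\<close>, which
  determines the coefficient of \<open>e\<^sub>1\<close>.
\<close>

lemma braid_op_SigmaInv_replicate:
  fixes A :: "'a::field"
  assumes "A \<noteq> 0" "length x \<ge> 2" "- A\<^sup>2 + inverse (- A\<^sup>2) \<noteq> 0"
  shows "braid_op A (replicate N (SigmaInv 1)) f x = inverse A ^ N * f x +
    ((- (A ^ 3)) ^ N - inverse A ^ N) / (- A\<^sup>2 + inverse (- A\<^sup>2)) * tl_gen (- A\<^sup>2) 1 f x"
  using assms(2)
proof (induction N arbitrary: x)
  case (Suc N)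
  let ?a = "- A\<^sup>2"
  let ?d = "?a + inverse ?a"
  let ?c = "\<lambda>N. ((- (A ^ 3)) ^ N - inverse A ^ N) / ?d"
  let ?e = "tl_gen ?a 1"
  note lin = linear_op_tl_gen[of ?a 1]
  have "?e (braid_op A (replicate N (SigmaInv 1)) f) x = ?e (\<lambda>y. inverse A ^ N * f y + ?c N * ?e f y) x"
    by (rule linear_op_cong[OF lin]) (use Suc in simp)
  also have "\<dots> = inverse A ^ N * ?e f x + ?c N * (?d * ?e f x)"
    using tl_gen_idem[of ?a 1 x f] assms(1) Suc.prems
    by (simp only: linear_op_add[OF lin] linear_op_scale[OF lin]) simp
  also have "\<dots> = (inverse A ^ N + ?c N * ?d) * ?e f x"
    by (simp only: distrib_right mult.assoc)
  also have "?c N * ?d = (- (A ^ 3)) ^ N - inverse A ^ N"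
  proof -
    have "u / e * e = u" if "e \<noteq> 0" for u e :: 'a using that by simp
    from this[OF assms(3)] show ?thesis .
  qed
  also have "inverse A ^ N + \<dots> = (- (A ^ 3)) ^ N" by simp
  finally have e: "?e (braid_op A (replicate N (SigmaInv 1)) f) x = (- (A ^ 3)) ^ N * ?e f x" .
  have "A * ?d = - (A ^ 3) - inverse A"
    using assms(1) by (simp add: field_simps eval_nat_numeral)
  hence "inverse A * ((- (A ^ 3)) ^ N - inverse A ^ N) + A * ?d * (- (A ^ 3)) ^ N =
      (- (A ^ 3)) ^ Suc N - inverse A ^ Suc N"
    by (simp only:) (simp add: algebra_simps)
  hence cS: "inverse A * ?c N + A * (- (A ^ 3)) ^ N = ?c (Suc N)"
  proof -
    have "i * (u / e) + B * v = r / e" if "e \<noteq> 0" "i * u + B * e * v = r" for i u e B v r :: 'a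
      using that by (auto simp: field_simps)
    from this[OF assms(3)] \<open>inverse A * _ + _ = _\<close> show ?thesis .
  qed
  have "braid_op A (replicate (Suc N) (SigmaInv 1)) f x =
     inverse A * (inverse A ^ N * f x + ?c N * ?e f x) + A * ((- (A ^ 3)) ^ N * ?e f x)"
    using e Suc.IH[of x] Suc.prems by simp
  also have "\<dots> = inverse A ^ Suc N * f x + (inverse A * ?c N + A * (- (A ^ 3)) ^ N) * ?e f x"
    by (simp only: power_Suc distrib_left distrib_right mult.assoc add.assoc)
  finally show ?case unfolding cS .
qed simp

definition t_quarter :: "rat fls" where
  "t_quarter = fls_X"

lemma t_quarter_nonzero: "t_quarter \<noteq> 0" by (simp add: t_quarter_def)

lemma t_quarter_powi_mult: "t_quarter powi a * t_quarter powi b = t_quarter powi (a + b)"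
  using t_quarter_nonzero by (simp add: power_int_add)

lemma t_var_powi: "t_var powi a = t_quarter powi (4 * a)" and t_half_powi: "t_half powi a = t_quarter powi (2 * a)"
  using t_quarter_nonzero by (simp_all add: t_var_def t_half_def t_quarter_def power_int_mult)

lemma t_var_neq: "t_var ^ n = 1 \<longleftrightarrow> n = 0"
proof -
  have "fls_subdegree (t_var ^ n) = 4 * int n" by (simp add: t_var_def fls_subdegree_pow)
  thus ?thesis by (metis fls_one_subdegree mult_eq_0_iff of_nat_eq_0_iff power_0 zero_neq_numeral)
qed

lemma minus_t_quarter_square_powi: "(- (t_quarter\<^sup>2)) powi S = (if even S then 1 else -1) * t_quarter powi (2 * S)"
  using t_quarter_nonzero by (simp add: power_int_minus_left power_int_mult)

text \<open>
  Both traces take this form.  The four monomials of \<open>J'\<close> come from the two states and the two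
  rotations; the monomial \<open>1\<close> belongs to the second rotation and the state of spin \<open>S\<close>.
\<close>

lemma rotation_terms_eq_J':
  fixes S n n' :: int
  defines "R \<equiv> rotation_terms (- (t_quarter\<^sup>2)) (inverse t_quarter) S n n'"
  shows "t_quarter ^ 4 * R 0 (-4) - R (-4) 0 =
     - (if even S then 1 else -1) * t_quarter powi (2 * S - (S - 5) * n + (S + 1) * n') * J' (- S) (n' - n)"
proof -
  define sg :: "rat fls" where "sg = (if even S then 1 else -1)"
  let ?e = "2 * S - (S - 5) * n + (S + 1) * n'"
  have inv: "inverse t_quarter powi a = t_quarter powi (- a)" for a by (simp add: power_int_minus power_int_inverse)
  have X4: "t_quarter ^ 4 = t_quarter powi 4" by simp
  have 1: "t_quarter ^ 4 * R 0 (-4) =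
      sg * (t_quarter powi (?e + 4 * (n' - n + 1)) + t_quarter powi (?e + 4 * (- S + 1)))"
    unfolding R_def rotation_terms_def minus_t_quarter_square_powi inv X4 even_minus sg_def[symmetric]
    unfolding distrib_left mult.assoc mult.left_commute[of _ sg] t_quarter_powi_mult
    by (simp add: algebra_simps)
  have 2: "R (-4) 0 = sg * (t_quarter powi ?e + t_quarter powi (?e + 4 * (- S + (n' - n))))"
    unfolding R_def rotation_terms_def minus_t_quarter_square_powi inv even_minus sg_def[symmetric]
    unfolding distrib_left mult.assoc t_quarter_powi_mult
    by (simp add: algebra_simps)
  have 3: "t_quarter powi ?e * J' (- S) (n' - n) =
      t_quarter powi ?e - t_quarter powi (?e + 4 * (- S + 1)) - t_quarter powi (?e + 4 * (n' - n + 1)) + t_quarter powi (?e + 4 * (- S + (n' - n)))"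
    unfolding J'_def t_var_powi by (simp only: distrib_left right_diff_distrib t_quarter_powi_mult mult_1_right)
  have ring: "sg * (a + b) - sg * (c + d) = - sg * (c - b - a + d)" for a b c d
    by (simp add: algebra_simps)
  show ?thesis
    unfolding 1 2 sg_def[symmetric] mult.assoc 3 by (rule ring)
qed

lemma geometric_sum_even:
  assumes "even N"
  shows "(1 + t_var) * (\<Sum>i<N. (-1) ^ i * t_var ^ i) = 1 - t_var ^ N"
proof -
  have "(\<Sum>i<N. (-1) ^ i * t_var ^ i) = (\<Sum>i<N. (- t_var) ^ i)"
    by (intro sum.cong refl) (simp add: power_mult_distrib[symmetric])
  thus ?thesis using one_diff_power_eq[of "- t_var" N] assms by simp
qed

text \<open>
  The case in which \<open>q k\<close> is 1 modulo \<open>p\<close>.  The signs \<open>(- 1)\<^sup>p\<close>, from the weights \<open>z\<close>, and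
  \<open>(- 1)\<^sup>w\<close>, from the writhe \<open>w\<close>, are opposite because \<open>p\<close> and \<open>q\<close> are not both even.
\<close>

lemma jones_twisted_torus_knot:
  fixes p q k l N :: nat
  assumes "coprime p q" "0 < k" "k < p" "q * k = p * l + 1" "even N"
  defines "E \<equiv> 2 * (- int N + k + l - int k * l) + (int k * q + int l * p + 1)"
  shows "jones p (twisted_torus_braid p q (- int N)) =
     t_quarter powi (2 * ((int p - 1) * (int q - 1) - int N)) / (1 - t_var ^ 2) *
     (J' p q - (\<Sum>i<N. (-1) ^ i * t_var ^ i) * t_quarter powi (2 * E) * J' (int p - 2 * k) (int q - 2 * l))"
proof -
  define A where "A = inverse t_quarter"
  define z where "z = - (t_quarter\<^sup>2)"
  define a where "a = - A\<^sup>2"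
  define d where "d = a + inverse a"
  define S where "S = (\<Sum>i<N. (-1) ^ i * t_var ^ i)"
  define c where "c = ((- (A ^ 3)) ^ N - inverse A ^ N) / d"
  define sg :: "rat fls" where "sg = (if even p then 1 else -1)"
  define w where "w = (int p - 1) * int q - int N"
  define kb where "kb = kauffman_bracket A p (twisted_torus_braid p q (- int N))"
  have A0: "A \<noteq> 0" and z0: "z \<noteq> 0" and a0: "a \<noteq> 0" using t_quarter_nonzero by (auto simp: A_def z_def a_def)
  have p2: "p \<ge> 2" using assms(2,3) by simp
  have zA: "z = - (A powi (-2))" by (simp add: z_def A_def power_int_minus power_inverse)
  have t4: "t_var = t_quarter powi 4" by (simp add: t_var_def t_quarter_def)
  have neq: "1 + t_var \<noteq> 0" "1 - t_var\<^sup>2 \<noteq> 0"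
  proof -
    show "1 - t_var\<^sup>2 \<noteq> 0" using t_var_neq[of 2] by auto
    moreover have "1 - t_var\<^sup>2 = (1 + t_var) * (1 - t_var)"
      by (simp add: algebra_simps power2_eq_square)
    ultimately show "1 + t_var \<noteq> 0" by auto
  qed
  have d: "d = - (t_quarter powi (-2)) * (1 + t_var)"
  proof -
    have "t_quarter powi (-2) * t_var = t_quarter powi 2" unfolding t4 t_quarter_powi_mult by simp
    thus ?thesis by (simp add: d_def a_def A_def power_int_minus algebra_simps power_inverse)
  qed
  hence d0: "d \<noteq> 0" using neq t_quarter_nonzero by (simp add: power_int_eq_0_iff)
  have c: "c = - (t_quarter powi (2 - 3 * int N)) * S"
  proof -
    have "(- (A ^ 3)) ^ N = t_quarter powi (- 3 * int N)" "inverse A ^ N = t_quarter powi (int N)"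
      using assms(5)
      by (simp_all add: A_def power_int_minus power_inverse power_int_mult flip: power_mult)
    moreover have "t_quarter powi (int N) = t_quarter powi (- 3 * int N) * t_var ^ N"
    proof -
      have "t_var ^ N = t_quarter powi (4 * int N)" using t_var_powi[of "int N"] by simp
      thus ?thesis by (simp add: t_quarter_powi_mult)
    qed
    moreover have cd: "c * d = (- (A ^ 3)) ^ N - inverse A ^ N" using d0 by (simp add: c_def)
    ultimately have "c * d = t_quarter powi (- 3 * int N) * ((1 + t_var) * S)"
      unfolding S_def geometric_sum_even[OF assms(5)] cd by (simp add: algebra_simps)
    also have "\<dots> = (- (t_quarter powi (2 - 3 * int N)) * S) * d"
    proof -
      have "t_quarter powi (2 - 3 * int N) * t_quarter powi (-2) = t_quarter powi (- 3 * int N)" by (simp add: t_quarter_powi_mult)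
      thus ?thesis by (simp add: d mult_ac)
    qed
    finally show ?thesis unfolding mult_right_cancel[OF d0] .
  qed
  let ?C = "braid_op A (coxeter p)"
  let ?F = "qtrace z p (?C ^^ q)" and ?G = "qtrace z p (\<lambda>f. (?C ^^ q) (cup_cap a f))"
  have braid: "twisted_torus_braid p q (- int N) = concat (replicate q (coxeter p)) @ replicate N (SigmaInv 1)"
    by (cases "N = 0") (auto simp: twisted_torus_braid_def coxeter_def sigma_pow_def)
  have "d * kb = qtrace z p (braid_op A (twisted_torus_braid p q (- int N)))"
  proof -
    have "crossing_index ` set (twisted_torus_braid p q (- int N)) \<subseteq> {1..<p}"
      using p2 by (auto simp: braid coxeter_def)
    from resolve_eq_qtrace[OF A0 _ _ this, of "[]"] p2 show ?thesis
      by (simp add: kb_def kauffman_bracket_def zA d_def a_def power_int_minus)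
  qed
  also have "\<dots> = qtrace z p (\<lambda>f x. inverse A ^ N * (?C ^^ q) f x + c * (?C ^^ q) (cup_cap a f) x)"
  proof (rule qtrace_same, unfold same_on_def, intro allI impI)
    fix f and x :: "bool list" assume x: "length x = p"
    have lin: "linear_op (?C ^^ q)" by (intro linear_op_funpow linear_op_braid_op)
    have "braid_op A (twisted_torus_braid p q (- int N)) f x = (?C ^^ q) (braid_op A (replicate N (SigmaInv 1)) f) x"
      by (simp add: braid braid_op_append braid_op_concat_replicate)
    also have "\<dots> = (?C ^^ q) (\<lambda>y. inverse A ^ N * f y + c * cup_cap a f y) x"
      by (rule linear_op_cong[OF lin])
        (use braid_op_SigmaInv_replicate[OF A0] d0 x p2 in \<open>simp add: c_def d_def a_def\<close>)
    finally show "braid_op A (twisted_torus_braid p q (- int N)) f x =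
        inverse A ^ N * (?C ^^ q) f x + c * (?C ^^ q) (cup_cap a f) x"
      by (simp only: linear_op_add[OF lin] linear_op_scale[OF lin])
  qed
  finally have dkb: "d * kb = t_quarter powi int N * ?F + c * ?G"
    by (simp add: qtrace_lincomb A_def)
  have z2: "z\<^sup>2 = t_quarter ^ 4" by (simp add: z_def flip: power_mult)
  have F: "(t_quarter ^ 4 - 1) * ?F = - sg * t_quarter powi (- 2 * int p - (int p - 1) * int q) * J' p q"
  proof -
    have "(t_quarter ^ 4 - 1) * ?F = t_quarter ^ 4 * qtrace z p (twisted_rotation A 0 (-4) ^^ q) - qtrace z p (twisted_rotation A (-4) 0 ^^ q)"
      using qtrace_coxeter_power[OF A0 _ z0 linear_op_id(1), of p q] p2 by (simp add: z2)
    also have "\<dots> = t_quarter ^ 4 * rotation_terms z A (- int p) 0 (int q) 0 (-4) - rotation_terms z A (- int p) 0 (int q) (-4) 0"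
      using qtrace_twisted_rotation[OF A0 assms(1)] p2 by simp
    finally show ?thesis unfolding z_def A_def rotation_terms_eq_J' by (simp add: sg_def algebra_simps)
  qed
  let ?S = "2 * int k - int p"
  let ?e = "2 * ?S - (?S - 5) * int l + (?S + 1) * (int q - int l)"
  have G: "(t_quarter ^ 4 - 1) * ?G = - sg * t_quarter powi ?e * J' (int p - 2 * k) (int q - 2 * l)"
  proof -
    have "raise A (cup_cap a f) = cup_cap a (raise A f)" for f
      using raise_cup_cap[OF a0, of A f] by (auto simp: a_def)
    hence "(t_quarter ^ 4 - 1) * ?G = t_quarter ^ 4 * qtrace z p (\<lambda>f. (twisted_rotation A 0 (-4) ^^ q) (cup_cap a f))
        - qtrace z p (\<lambda>f. (twisted_rotation A (-4) 0 ^^ q) (cup_cap a f))"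
      using qtrace_coxeter_power[OF A0 _ z0 linear_op_cup_cap, of p a q] p2 by (simp add: z2)
    also have "\<dots> = t_quarter ^ 4 * rotation_terms z A ?S (int l) (int q - int l) 0 (-4)
        - rotation_terms z A ?S (int l) (int q - int l) (-4) 0"
      unfolding qtrace_twisted_rotation_cup_cap[OF assms(1-4) A0 a0] ..
    finally show ?thesis unfolding z_def A_def rotation_terms_eq_J' by (simp add: sg_def algebra_simps)
  qed
  define P where "P = t_quarter powi (int N + (- 2 * int p - (int p - 1) * int q)) * J' p q -
      t_quarter powi (2 - 3 * int N + ?e) * S * J' (int p - 2 * k) (int q - 2 * l)"
  have "(1 - t_var\<^sup>2) * kb = - sg * t_quarter powi 2 * P"
  proof -
    have "(t_quarter ^ 4 - 1) * (d * kb) = t_quarter powi int N * ((t_quarter ^ 4 - 1) * ?F) + c * ((t_quarter ^ 4 - 1) * ?G)"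
      by (simp add: dkb algebra_simps)
    also have "\<dots> = - sg * P"
    proof -
      have "u * (- sg * u' * j) + - v * S * (- sg * v' * j') = - sg * (u * u' * j - v * v' * S * j')"
        for u u' v v' j j' by (simp add: algebra_simps)
      thus ?thesis unfolding F G c P_def t_quarter_powi_mult[symmetric, of "int N"] t_quarter_powi_mult[symmetric, of "2 - 3 * int N"] .
    qed
    finally have "t_quarter powi 2 * ((t_quarter ^ 4 - 1) * (d * kb)) = - sg * t_quarter powi 2 * P" by simp
    moreover have "t_quarter powi 2 * ((t_quarter ^ 4 - 1) * d) = 1 - t_var\<^sup>2"
    proof -
      have "t_quarter powi 2 * d = - (1 + t_var)" by (simp add: d t_quarter_powi_mult[symmetric] mult.assoc[symmetric]) (use t_quarter_nonzero in \<open>simp add: power_int_minus\<close>)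
      moreover have "t_quarter ^ 4 = t_var" by (simp add: t4)
      ultimately have "(t_quarter ^ 4 - 1) * (t_quarter powi 2 * d) = (t_var - 1) * (- (1 + t_var))" by (simp only:)
      also have "\<dots> = 1 - t_var\<^sup>2" by (simp add: algebra_simps power2_eq_square)
      finally show ?thesis by (simp only: mult.left_commute)
    qed
    ultimately show ?thesis by (simp only: mult.assoc[symmetric])
  qed
  hence kb: "kb = - sg * t_quarter powi 2 * P / (1 - t_var\<^sup>2)" using neq by (simp add: field_simps)
  have writhe: "writhe (twisted_torus_braid p q (- int N)) = w"
  proof -
    have "writhe (concat (replicate q v)) = int q * writhe v" for v
      by (induction q) (auto simp: writhe_def algebra_simps)
    moreover have "writhe (coxeter p) = int p - 1"
      using p2 by (simp add: writhe_def coxeter_def sum_list_triv comp_def of_nat_diff)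
    moreover have "writhe (replicate N (SigmaInv 1)) = - int N"
      by (induction N) (auto simp: writhe_def)
    moreover have "writhe (u @ v) = writhe u + writhe v" for u v by (simp add: writhe_def)
    ultimately show ?thesis by (simp only: braid w_def mult.commute[of "int q"] uminus_add_conv_diff diff_conv_add_uminus)
  qed
  have sign: "(- A) powi (- 3 * w) = - sg * t_quarter powi (3 * w)"
  proof -
    have "even w \<longleftrightarrow> odd p"
    proof -
      have "odd p \<or> odd q" using coprime_common_divisor[OF assms(1), of 2] by auto
      thus ?thesis using assms(5) by (auto simp: w_def)
    qed
    thus ?thesis by (simp add: A_def sg_def power_int_minus_left power_int_minus power_int_inverse)
  qed
  have "sg * sg = 1" by (simp add: sg_def)
  hence sgt: "sg * (sg * t) = t" for t by (simp add: mult.assoc[symmetric])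
  have "jones p (twisted_torus_braid p q (- int N)) = t_quarter powi (3 * w + 2) * P / (1 - t_var\<^sup>2)"
  proof -
    have "jones p (twisted_torus_braid p q (- int N)) = (- A) powi (- 3 * w) * kb"
      by (simp add: jones_def aux_poly_def writhe kb_def A_def t_quarter_def power_int_minus)
    also have "\<dots> = t_quarter powi (3 * w) * t_quarter powi 2 * P / (1 - t_var\<^sup>2)"
      unfolding sign kb by (simp add: sgt mult.assoc)
    finally show ?thesis by (simp only: t_quarter_powi_mult)
  qed
  also have "t_quarter powi (3 * w + 2) * P = t_quarter powi (2 * ((int p - 1) * (int q - 1) - int N)) *
      (J' p q - S * t_quarter powi (2 * E) * J' (int p - 2 * k) (int q - 2 * l))"
  proof -
    let ?m = "2 * ((int p - 1) * (int q - 1) - int N)"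
    have e: "3 * w + 2 + (int N + (- 2 * int p - (int p - 1) * int q)) = ?m"
       "3 * w + 2 + (2 - 3 * int N + ?e) = ?m + 2 * E"
      by (simp_all add: w_def E_def algebra_simps)
    have "t_quarter powi (3 * w + 2) * P = t_quarter powi (3 * w + 2 + (int N + (- 2 * int p - (int p - 1) * int q))) * J' p q -
        t_quarter powi (3 * w + 2 + (2 - 3 * int N + ?e)) * S * J' (int p - 2 * k) (int q - 2 * l)"
      by (simp only: P_def right_diff_distrib mult.assoc[symmetric] t_quarter_powi_mult)
    also have "\<dots> = t_quarter powi ?m * J' p q - t_quarter powi ?m * t_quarter powi (2 * E) * S * J' (int p - 2 * k) (int q - 2 * l)"
      unfolding e by (simp only: t_quarter_powi_mult)
    also have "m * j - m * v * S * j' = m * (j - S * v * j')" for m j v j'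
      by (simp add: algebra_simps)
    finally show ?thesis .
  qed
  finally show ?thesis by (simp add: S_def)
qed

text \<open>
  This identity makes the formula invariant under \<open>(k, l) \<mapsto> (p - k, q - l)\<close>.
\<close>

lemma J'_uminus: "J' (- a) (- b) = t_quarter powi (- 4 * (a + b)) * J' a b"
proof -
  have "t_quarter powi (- 4 * (a + b)) * J' a b = t_quarter powi (- 4 * (a + b)) - t_quarter powi (- 4 * (a + b) + 4 * (a + 1))
      - t_quarter powi (- 4 * (a + b) + 4 * (b + 1)) + t_quarter powi (- 4 * (a + b) + 4 * (a + b))"
    unfolding J'_def t_var_powi by (simp only: distrib_left right_diff_distrib t_quarter_powi_mult mult_1_right)
  thus ?thesis by (simp add: J'_def t_var_powi algebra_simps)
qed

theorem theorem3p11: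
  fixes p q s n k l :: int
  assumes "p \<ge> 3" and "q \<ge> 1" and "coprime p q"
    and "n < 0" and "s = 2 * n"
    and "twist_params p q k l"
  shows "jones (nat p) (twisted_torus_braid (nat p) (nat q) s) =
    t_half powi ((p - 1) * (q - 1) - \<bar>s\<bar>) / (1 - t_var ^ 2) *
    (J' p q -
      (\<Sum>i<nat \<bar>s\<bar>. (-1) ^ i *
         t_half powi (2 * (int i - \<bar>s\<bar> + k + l - k * l) + (k * q + l * p + 1)) *
         J' (p - 2 * k) (q - 2 * l)))"
proof -
  define E where "E = (\<lambda>k l. 2 * (s + k + l - k * l) + (k * q + l * p + 1))"
  have sum: "(\<Sum>i<nat \<bar>s\<bar>. (-1) ^ i *
         t_half powi (2 * (int i - \<bar>s\<bar> + k + l - k * l) + (k * q + l * p + 1)) * J' (p - 2 * k) (q - 2 * l))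
     = (\<Sum>i<nat \<bar>s\<bar>. (-1) ^ i * t_var ^ i) * t_quarter powi (2 * E k l) * J' (p - 2 * k) (q - 2 * l)"
    unfolding sum_distrib_right
  proof (intro sum.cong refl)
    fix i
    have "t_half powi (2 * (int i - \<bar>s\<bar> + k + l - k * l) + (k * q + l * p + 1)) = t_quarter powi (4 * int i + 2 * E k l)"
      unfolding t_half_powi using assms(4,5) by (intro arg_cong[of _ _ "power_int t_quarter"]) (simp add: E_def)
    also have "\<dots> = t_var ^ i * t_quarter powi (2 * E k l)"
      using t_var_powi[of "int i"] by (simp add: t_quarter_powi_mult[symmetric])
    finally show "(-1) ^ i * t_half powi (2 * (int i - \<bar>s\<bar> + k + l - k * l) + (k * q + l * p + 1)) * J' (p - 2 * k) (q - 2 * l)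
       = (-1) ^ i * t_var ^ i * t_quarter powi (2 * E k l) * J' (p - 2 * k) (q - 2 * l)" by simp
  qed
  have main: "jones (nat p) (twisted_torus_braid (nat p) (nat q) s) =
    t_quarter powi (2 * ((p - 1) * (q - 1) - \<bar>s\<bar>)) / (1 - t_var ^ 2) *
    (J' p q - (\<Sum>i<nat \<bar>s\<bar>. (-1) ^ i * t_var ^ i) * t_quarter powi (2 * E k l) * J' (p - 2 * k) (q - 2 * l))"
    if "0 < k" "k < p" "q * k = p * l + 1" for k l
  proof -
    have "p * l \<ge> 0" using that assms(2) by (smt (verit) mult_pos_pos)
    hence l: "l \<ge> 0" using assms(1) by (simp add: zero_le_mult_iff)
    have eq: "nat q * nat k = nat p * nat l + 1"
      using that assms(1,2) l by (simp flip: nat_mult_distrib) (simp add: nat_add_distrib)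
    have cop: "coprime (nat p) (nat q)" using assms(1,2,3) by (simp add: coprime_int_iff[symmetric])
    show ?thesis
      using jones_twisted_torus_knot[OF cop _ _ eq, of "nat \<bar>s\<bar>"] that l assms(1,2,4,5)
      by (simp add: E_def even_nat_iff)
  qed
  from assms(6) obtain i where k: "k > 0" and min: "\<And>k' i. 0 < k' \<Longrightarrow> k' < k \<Longrightarrow> \<not> admissible p q k' i"
    and i: "admissible p q k i" "p * l + i - 1 = q * k"
    unfolding twist_params_def by blast
  have adm: "admissible p q k' j \<longleftrightarrow> j \<in> {0, 1, 2} \<and> p dvd (1 + q * k' - j)" for k' j
  proof -
    have "[1 + (q mod p) * k' = j] (mod p) \<longleftrightarrow> [1 + q * k' = j] (mod p)"
    proof -
      have "[1 + (q mod p) * k' = 1 + q * k'] (mod p)"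
        by (intro cong_add cong_mult cong_refl) simp
      thus ?thesis by (meson cong_sym cong_trans)
    qed
    thus ?thesis by (simp add: admissible_def cong_iff_dvd_diff)
  qed
  \<comment> \<open>otherwise the inverse of \<open>q\<close> modulo \<open>p\<close> would be a smaller choice for \<open>k\<close>\<close>
  have kp: "k < p"
  proof (rule ccontr)
    assume "\<not> k < p"
    obtain x where x: "[q * x = 1] (mod p)"
      using cong_solve_coprime_int[of q p] assms(3) by (auto simp: coprime_commute)
    define k' where "k' = x mod p"
    have k': "[q * k' = 1] (mod p)" using x by (simp add: k'_def cong_def mod_simps)
    have "k' \<noteq> 0" using k' assms(1) by (auto simp: cong_def)
    hence "0 < k'" "k' < p" using assms(1) pos_mod_bound[of p x] pos_mod_sign[of p x] by (auto simp: k'_def less_le)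
    moreover have "admissible p q k' 2"
      using k' unfolding adm by (simp add: cong_iff_dvd_diff algebra_simps)
    ultimately show False using min[of k' 2] \<open>\<not> k < p\<close> by simp
  qed
  have "i \<noteq> 1"
  proof
    assume "i = 1"
    hence "p dvd q * k" using i by (metis add_diff_cancel_right' dvd_triv_left)
    hence "p dvd k" using assms(3) by (simp add: coprime_dvd_mult_right_iff)
    thus False using k kp by (auto dest: zdvd_imp_le)
  qed
  hence "i = 2 \<or> i = 0" using i by (auto simp: admissible_def)
  thus ?thesis
  proof
    assume "i = 2"
    thus ?thesis unfolding sum unfolding t_half_powi using main[OF k kp] i by simp
  next
    assume "i = 0"
    hence kl: "q * k = p * l - 1" using i by simp
    have "t_quarter powi (2 * E (p - k) (q - l)) * J' (p - 2 * (p - k)) (q - 2 * (q - l)) = t_quarter powi (2 * E k l) * J' (p - 2 * k) (q - 2 * l)"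
    proof -
      have "2 * E (p - k) (q - l) + - 4 * (p - 2 * k + (q - 2 * l)) = 2 * E k l"
        by (simp add: E_def algebra_simps)
      moreover have "J' (p - 2 * (p - k)) (q - 2 * (q - l)) = t_quarter powi (- 4 * (p - 2 * k + (q - 2 * l))) * J' (p - 2 * k) (q - 2 * l)"
        using J'_uminus[of "p - 2 * k" "q - 2 * l"] by (simp add: algebra_simps)
      ultimately show ?thesis by (simp only: mult.assoc[symmetric] t_quarter_powi_mult)
    qed
    moreover have "q * (p - k) = p * (q - l) + 1" using kl by (simp add: algebra_simps)
    ultimately show ?thesis
      unfolding sum unfolding t_half_powi using main[of "p - k" "q - l"] k kp by (simp add: mult.assoc)
  qed
qed

end
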